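(* Let $G$ be a connected finite-dimensional Lie group with Lie algebra $\mathfrak{g}$, $M$ a smooth connected manifold, $h\colon G\times M\to M$ a transitive right Lie group action, $y_0\in M$ a fixed point with $\operatorname{stab}(y_0)$ closed in $G$, $h_{y_0}(X)=h(X,y_0)$ and $h_X(y)=h(X,y)$. Consider the projected system on $M$ $$\dot y = T_Xh_{y_0}(Xu),\qquad X\in h_{y_0}^{-1}(y),$$ and an observer with an internal model of this system, $$\dot{\hat y} = T_{\hat X}h_{y_0}(\hat Xu)+\alpha(\hat y,u,y,t),\qquad \hat X\in h_{y_0}^{-1}(\hat y),$$ where $\alpha$ is an innovation term. The dynamics of the canonical error $e$ of this observer is autonomous if and only if the innovation term $\alpha$ is equivariant and does not depend on $u$ or $t$. The autonomous error dynamics has the form $$\frac{d}{dt}e=\alpha(e,y_0),$$ where $\alpha(\hat y,y)$ denotes the innovation term $\alpha(\hat y,u,y,t)$ not depending on $u$ or $t$.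
   Context: Right action means $h(X,h(Y,y))=h(YX,y)$. $\operatorname{stab}(y_0)=\{X\in G\mid h(X,y_0)=y_0\}$. For $X\in G$, $u\in\mathfrak{g}$, $Xu:=T_eL_Xu$ with $L_X$ left multiplication. The expression $T_Xh_{y_0}(Xu)$ depends only on $h_{y_0}(X)$ and $u$, so it defines a system on $M$. An input $u\colon\mathbb{R}\to\mathfrak{g}$ is admissible if $\dot X=Xu(t)$ has unique solutions for all initial values. Write $y(t,z,u)$ for the solution of the projected system with initial value $z\in M$ and input $u$, and $\hat y(t,z,y(t,z,u),u)$ for the observer solution with initial value $z$, driven by $y(\cdot,z,u)$ and $u$. The observer has an internal model of the projected system if $\hat y(t,z,y(t,z,u),u)=y(t,z,u)$ for all admissible $u$, all $z\in M$ and all $t\in\mathbb{R}^+$. An innovation term is a map $\alpha\colon M\times\mathfrak{g}\times M\times\mathbb{R}\to TM$ such that (a) $\alpha(\hat y,u,y,t)\in T_{\hat y}M$; (b) $\alpha\big(\hat y(t,z,y(t,z,u),u),u(t),y(t,z,u),t\big)=0$ for all $z\in M$, all $t\in\mathbb{R}$ and all admissible inputs $u$. The innovation term is equivariant if for all $S\in G$, $y,\hat y\in M$, $u\in\mathfrak{g}$, $t\in\mathbb{R}$: $T_{\hat y}h_S\,\alpha(\hat y,u,y,t)=\alpha(h_S(\hat y),u,h_S(y),t)$. The canonical error function on $M\times M$, which is regarded as well-defined and smooth, is $$e(\hat x,x)=h(\hat XX^{-1},y_0)\quad\text{with } h_{y_0}(\hat X)=\hat x,\ h_{y_0}(X)=x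 .$$ The canonical error of the observer is $e=e(\hat y,y)$ for solutions $y(t)$ of the projected system and $\hat y(t)$ of the observer. Its dynamics is autonomous if $\frac{d}{dt}e=F(e)$ for a function $F\colon M\to TM$.
   Formalization: Added hypothesis: for continuous admissible inputs the observer has a local solution through every initial state at every initial time (true for continuous α); without it "autonomous" can hold vacuously for an innovation term that depends on t. *)

theory Defs
  imports "HOL-Analysis.Analysis" "HOL-Algebra.Group"
begin

section \<open>Smooth manifolds\<close>

text \<open>
  Only used on open sets of finite-dimensional normed spaces, where continuity of all iterated
  directional derivatives is the same as being of class \<open>C\<^sup>k\<close>.
\<close>

primrec Ck_on ::
    "nat \<Rightarrow> 'a::real_normed_vector set \<Rightarrow> ('a \<Rightarrow> 'b::real_normed_vector) \<Rightarrow> bool" where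
  "Ck_on 0 S f \<longleftrightarrow> continuous_on S f"
| "Ck_on (Suc k) S f \<longleftrightarrow>
     (\<forall>x\<in>S. f differentiable (at x)) \<and> (\<forall>v. Ck_on k S (\<lambda>x. frechet_derivative f (at x) v))"

definition smooth_on ::
    "'a::real_normed_vector set \<Rightarrow> ('a \<Rightarrow> 'b::real_normed_vector) \<Rightarrow> bool" where
  "smooth_on S f \<longleftrightarrow> (\<forall>k. Ck_on k S f)"

text \<open>
  A chart is a pair \<open>(U, \<phi>)\<close>; only the values of \<open>\<phi>\<close> on \<open>U\<close> matter, and its inverse is
  \<open>inv_into U \<phi>\<close>.
\<close>

type_synonym ('m, 'b) chart = "'m set \<times> ('m \<Rightarrow> 'b)"
type_synonym ('m, 'b) atlas = "('m, 'b) chart set"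

definition is_chart ::
    "('m::topological_space, 'b::real_normed_vector) chart \<Rightarrow> bool" where
  "is_chart = (\<lambda>(U, \<phi>). open U \<and> open (\<phi> ` U) \<and> homeomorphism U (\<phi> ` U) \<phi> (inv_into U \<phi>))"

text \<open>
  A manifold is a whole type together with an atlas (not required to be maximal). The model space
  is an arbitrary finite-dimensional normed space rather than a type of class
  \<open>euclidean_space\<close>, because the latter would exclude dimension zero.
\<close>

definition smooth_manifold ::
    "('m::{t2_space,second_countable_topology}, 'b::real_normed_vector) atlas \<Rightarrow> bool" where
  "smooth_manifold A \<longleftrightarrow>
     (\<exists>D::'b set. finite D \<and> span D = UNIV) \<and>
     (\<forall>c\<in>A. is_chart c) \<and>
     (\<Union>(U, \<phi>)\<in>A. U) = UNIV \<and>
     (\<forall>(U, \<phi>)\<in>A. \<forall>(V, \<psi>)\<in>A. smooth_on (\<phi> ` (U \<inter> V)) (\<psi> \<circ> inv_into U \<phi>))"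

definition prod_atlas ::
    "('m, 'b) atlas \<Rightarrow> ('n, 'c) atlas \<Rightarrow> ('m \<times> 'n, 'b \<times> 'c) atlas" where
  "prod_atlas A B = {(U \<times> V, map_prod \<phi> \<psi>) |U \<phi> V \<psi>. (U, \<phi>) \<in> A \<and> (V, \<psi>) \<in> B}"

definition smooth_map ::
    "('m::topological_space, 'b::real_normed_vector) atlas \<Rightarrow>
     ('n::topological_space, 'c::real_normed_vector) atlas \<Rightarrow> ('m \<Rightarrow> 'n) \<Rightarrow> bool" where
  "smooth_map A B f \<longleftrightarrow>
     continuous_on UNIV f \<and>
     (\<forall>(U, \<phi>)\<in>A. \<forall>(V, \<psi>)\<in>B. smooth_on (\<phi> ` (U \<inter> f -` V)) (\<psi> \<circ> f \<circ> inv_into U \<phi>))"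

section \<open>Tangent vectors\<close>

text \<open>
  A tangent vector at \<open>p\<close> is given by its coordinates in every chart around \<open>p\<close>, related by the
  derivatives of the transition maps; the value 0 at all other arguments makes the representation
  unique. Addition and zero in a tangent space are pointwise. The same function (for instance
  zero) may lie in several tangent spaces, so elements of the tangent bundle always occur together
  with their base point.
\<close>

type_synonym ('m, 'b) tvec = "('m, 'b) chart \<Rightarrow> 'b"

definition tangent_space ::
    "('m, 'b::real_normed_vector) atlas \<Rightarrow> 'm \<Rightarrow> ('m, 'b) tvec set" where
  "tangent_space A p = {v.
     (\<forall>(U, \<phi>)\<in>A. \<forall>(V, \<psi>)\<in>A. p \<in> U \<and> p \<in> V \<longrightarrow>
        v (V, \<psi>) = frechet_derivative (\<psi> \<circ> inv_into U \<phi>) (at (\<phi> p)) (v (U, \<phi>))) \<and>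
     (\<forall>U \<phi>. (U, \<phi>) \<notin> A \<or> p \<notin> U \<longrightarrow> v (U, \<phi>) = 0)}"

text \<open>
  The tangent map \<open>T\<^sub>p f\<close>. For smooth \<open>f\<close> and \<open>v \<in> tangent_space A p\<close> the result does not depend
  on the chart chosen at \<open>p\<close>.
\<close>

definition tmap ::
    "('m, 'b::real_normed_vector) atlas \<Rightarrow> ('n, 'c::real_normed_vector) atlas \<Rightarrow>
     ('m \<Rightarrow> 'n) \<Rightarrow> 'm \<Rightarrow> ('m, 'b) tvec \<Rightarrow> ('n, 'c) tvec" where
  "tmap A B f p v = (\<lambda>(V, \<psi>).
     if (V, \<psi>) \<in> B \<and> f p \<in> V then
       (let (U, \<phi>) = (SOME c. c \<in> A \<and> p \<in> fst c)
        in frechet_derivative (\<psi> \<circ> f \<circ> inv_into U \<phi>) (at (\<phi> p)) (v (U, \<phi>)))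
     else 0)"

definition has_velocity ::
    "('m::topological_space, 'b::real_normed_vector) atlas \<Rightarrow>
     (real \<Rightarrow> 'm) \<Rightarrow> ('m, 'b) tvec \<Rightarrow> real \<Rightarrow> bool" where
  "has_velocity A c v t \<longleftrightarrow>
     v \<in> tangent_space A (c t) \<and> isCont c t \<and>
     (\<forall>(U, \<phi>)\<in>A. c t \<in> U \<longrightarrow> ((\<lambda>s. \<phi> (c s)) has_vector_derivative v (U, \<phi>)) (at t))"

section \<open>Lie groups and right actions\<close>

definition lie_group ::
    "'g::{t2_space,second_countable_topology} monoid \<Rightarrow>
     ('g, 'a::real_normed_vector) atlas \<Rightarrow> bool" where
  "lie_group G A \<longleftrightarrow>
     group G \<and> carrier G = UNIV \<and> smooth_manifold A \<and>
     smooth_map (prod_atlas A A) A (\<lambda>(X, Y). X \<otimes>\<^bsub>G\<^esub> Y) \<and>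
     smooth_map A A (\<lambda>X. inv\<^bsub>G\<^esub> X)"

definition lie_alg ::
    "'g monoid \<Rightarrow> ('g, 'a::real_normed_vector) atlas \<Rightarrow> ('g, 'a) tvec set" where
  "lie_alg G A = tangent_space A \<one>\<^bsub>G\<^esub>"

text \<open>\<open>X u = T\<^sub>e L\<^sub>X u\<close>\<close>

definition left_shift ::
    "'g monoid \<Rightarrow> ('g, 'a::real_normed_vector) atlas \<Rightarrow> 'g \<Rightarrow> ('g, 'a) tvec \<Rightarrow> ('g, 'a) tvec" where
  "left_shift G A X u = tmap A A (\<lambda>Y. X \<otimes>\<^bsub>G\<^esub> Y) \<one>\<^bsub>G\<^esub> u"

definition right_lie_action ::
    "'g::topological_space monoid \<Rightarrow> ('g, 'a::real_normed_vector) atlas \<Rightarrow>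
     ('m::topological_space, 'b::real_normed_vector) atlas \<Rightarrow> ('g \<Rightarrow> 'm \<Rightarrow> 'm) \<Rightarrow> bool" where
  "right_lie_action G A B h \<longleftrightarrow>
     smooth_map (prod_atlas A B) B (\<lambda>(X, y). h X y) \<and>
     (\<forall>y. h \<one>\<^bsub>G\<^esub> y = y) \<and>
     (\<forall>X Y y. h X (h Y y) = h (Y \<otimes>\<^bsub>G\<^esub> X) y)"

definition transitive_act :: "('g \<Rightarrow> 'm \<Rightarrow> 'm) \<Rightarrow> bool" where
  "transitive_act h \<longleftrightarrow> (\<forall>y z. \<exists>X. h X y = z)"

definition stab :: "('g \<Rightarrow> 'm \<Rightarrow> 'm) \<Rightarrow> 'm \<Rightarrow> 'g set" where
  "stab h y = {X. h X y = y}"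

section \<open>The projected system and its observers\<close>

text \<open>
  Solutions are everywhere differentiable curves satisfying the differential equation at every
  time; initial values are prescribed at time 0.
\<close>

definition admissible ::
    "'g::topological_space monoid \<Rightarrow> ('g, 'a::real_normed_vector) atlas \<Rightarrow>
     (real \<Rightarrow> ('g, 'a) tvec) \<Rightarrow> bool" where
  "admissible G A u \<longleftrightarrow>
     (\<forall>t. u t \<in> lie_alg G A) \<and>
     (\<forall>X0. \<exists>!X. X 0 = X0 \<and> (\<forall>t. has_velocity A X (left_shift G A (X t) (u t)) t))"

text \<open>
  The right-hand side of the projected system. Any \<open>X\<close> over \<open>y\<close> gives the same vector, since
  \<open>X\<close> is determined up to left multiplication with an element of the stabilizer of \<open>y0\<close>.
\<close>

definition proj_field ::
    "'g monoid \<Rightarrow> ('g, 'a::real_normed_vector) atlas \<Rightarrow> ('m, 'b::real_normed_vector) atlas \<Rightarrow>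
     ('g \<Rightarrow> 'm \<Rightarrow> 'm) \<Rightarrow> 'm \<Rightarrow> 'm \<Rightarrow> ('g, 'a) tvec \<Rightarrow> ('m, 'b) tvec" where
  "proj_field G A B h y0 y u =
     (let X = (SOME X. h X y0 = y) in tmap A B (\<lambda>Y. h Y y0) X (left_shift G A X u))"

definition proj_solution ::
    "'g monoid \<Rightarrow> ('g, 'a::real_normed_vector) atlas \<Rightarrow>
     ('m::topological_space, 'b::real_normed_vector) atlas \<Rightarrow>
     ('g \<Rightarrow> 'm \<Rightarrow> 'm) \<Rightarrow> 'm \<Rightarrow> (real \<Rightarrow> ('g, 'a) tvec) \<Rightarrow> (real \<Rightarrow> 'm) \<Rightarrow> bool" where
  "proj_solution G A B h y0 u y \<longleftrightarrow>
     (\<forall>t. has_velocity B y (proj_field G A B h y0 (y t) (u t)) t)"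

text \<open>
  Innovation terms are written with arguments in the order \<open>\<alpha> yh u y t\<close>, where \<open>yh\<close> is the
  observer state. A priori observer solutions exist only on open intervals \<open>I\<close>.
\<close>

type_synonym ('g, 'a, 'm, 'b) innov =
  "'m \<Rightarrow> ('g, 'a) tvec \<Rightarrow> 'm \<Rightarrow> real \<Rightarrow> ('m, 'b) tvec"

definition obs_solution ::
    "'g monoid \<Rightarrow> ('g, 'a::real_normed_vector) atlas \<Rightarrow>
     ('m::topological_space, 'b::real_normed_vector) atlas \<Rightarrow>
     ('g \<Rightarrow> 'm \<Rightarrow> 'm) \<Rightarrow> 'm \<Rightarrow> ('g, 'a, 'm, 'b) innov \<Rightarrow>
     (real \<Rightarrow> ('g, 'a) tvec) \<Rightarrow> (real \<Rightarrow> 'm) \<Rightarrow> real set \<Rightarrow> (real \<Rightarrow> 'm) \<Rightarrow> bool" where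
  "obs_solution G A B h y0 \<alpha> u y I yh \<longleftrightarrow>
     open I \<and> is_interval I \<and>
     (\<forall>t\<in>I. has_velocity B yh
        (\<lambda>c. proj_field G A B h y0 (yh t) (u t) c + \<alpha> (yh t) (u t) (y t) t c) t)"

text \<open>\<open>w\<close> is a value at time \<open>t\<close> of the observer solution with initial value \<open>z\<close>.\<close>

definition obs_value ::
    "'g monoid \<Rightarrow> ('g, 'a::real_normed_vector) atlas \<Rightarrow>
     ('m::topological_space, 'b::real_normed_vector) atlas \<Rightarrow>
     ('g \<Rightarrow> 'm \<Rightarrow> 'm) \<Rightarrow> 'm \<Rightarrow> ('g, 'a, 'm, 'b) innov \<Rightarrow>
     (real \<Rightarrow> ('g, 'a) tvec) \<Rightarrow> (real \<Rightarrow> 'm) \<Rightarrow> 'm \<Rightarrow> real \<Rightarrow> 'm \<Rightarrow> bool" where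
  "obs_value G A B h y0 \<alpha> u y z t w \<longleftrightarrow>
     (\<exists>I yh. 0 \<in> I \<and> t \<in> I \<and> obs_solution G A B h y0 \<alpha> u y I yh \<and> yh 0 = z \<and> yh t = w)"

text \<open>The equivalence says that the observer solution exists up to time \<open>t\<close> and equals \<open>y t\<close> there.\<close>

definition internal_model ::
    "'g::topological_space monoid \<Rightarrow> ('g, 'a::real_normed_vector) atlas \<Rightarrow>
     ('m::topological_space, 'b::real_normed_vector) atlas \<Rightarrow>
     ('g \<Rightarrow> 'm \<Rightarrow> 'm) \<Rightarrow> 'm \<Rightarrow> ('g, 'a, 'm, 'b) innov \<Rightarrow> bool" where
  "internal_model G A B h y0 \<alpha> \<longleftrightarrow>
     (\<forall>u z y. admissible G A u \<and> proj_solution G A B h y0 u y \<and> y 0 = z \<longrightarrow>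
        (\<forall>t\<ge>0. \<forall>w. obs_value G A B h y0 \<alpha> u y z t w \<longleftrightarrow> w = y t))"

definition innovation_term ::
    "'g::topological_space monoid \<Rightarrow> ('g, 'a::real_normed_vector) atlas \<Rightarrow>
     ('m::topological_space, 'b::real_normed_vector) atlas \<Rightarrow>
     ('g \<Rightarrow> 'm \<Rightarrow> 'm) \<Rightarrow> 'm \<Rightarrow> ('g, 'a, 'm, 'b) innov \<Rightarrow> bool" where
  "innovation_term G A B h y0 \<alpha> \<longleftrightarrow>
     (\<forall>yh y t. \<forall>u\<in>lie_alg G A. \<alpha> yh u y t \<in> tangent_space B yh) \<and>
     (\<forall>u z y. admissible G A u \<and> proj_solution G A B h y0 u y \<and> y 0 = z \<longrightarrow>
        (\<forall>t w. obs_value G A B h y0 \<alpha> u y z t w \<longrightarrow> \<alpha> w (u t) (y t) t = (\<lambda>c. 0)))"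

text \<open>
  That the observer has solutions at all is a genuine hypothesis on \<open>\<alpha>\<close>, of which no regularity
  is assumed. It is only demanded for continuous inputs, so that it holds for instance whenever
  \<open>\<alpha>\<close> is continuous; uniqueness is not demanded.
\<close>

definition obs_solvable ::
    "'g::topological_space monoid \<Rightarrow> ('g, 'a::real_normed_vector) atlas \<Rightarrow>
     ('m::topological_space, 'b::real_normed_vector) atlas \<Rightarrow>
     ('g \<Rightarrow> 'm \<Rightarrow> 'm) \<Rightarrow> 'm \<Rightarrow> ('g, 'a, 'm, 'b) innov \<Rightarrow> bool" where
  "obs_solvable G A B h y0 \<alpha> \<longleftrightarrow>
     (\<forall>u y. admissible G A u \<and> (\<forall>c. continuous_on UNIV (\<lambda>t. u t c)) \<and>
            proj_solution G A B h y0 u y \<longrightarrow>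
        (\<forall>t0 z. \<exists>I yh. t0 \<in> I \<and> obs_solution G A B h y0 \<alpha> u y I yh \<and> yh t0 = z))"

definition equivariant ::
    "'g monoid \<Rightarrow> ('g, 'a::real_normed_vector) atlas \<Rightarrow> ('m, 'b::real_normed_vector) atlas \<Rightarrow>
     ('g \<Rightarrow> 'm \<Rightarrow> 'm) \<Rightarrow> ('g, 'a, 'm, 'b) innov \<Rightarrow> bool" where
  "equivariant G A B h \<alpha> \<longleftrightarrow>
     (\<forall>S y yh t. \<forall>u\<in>lie_alg G A.
        tmap B B (h S) yh (\<alpha> yh u y t) = \<alpha> (h S yh) u (h S y) t)"

definition indep_of_input_time ::
    "'g monoid \<Rightarrow> ('g, 'a::real_normed_vector) atlas \<Rightarrow> ('g, 'a, 'm, 'b) innov \<Rightarrow> bool" where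
  "indep_of_input_time G A \<alpha> \<longleftrightarrow>
     (\<forall>yh y t t'. \<forall>u\<in>lie_alg G A. \<forall>u'\<in>lie_alg G A. \<alpha> yh u y t = \<alpha> yh u' y t')"

section \<open>The canonical error\<close>

text \<open>
  Since the equation is required for all \<open>Xh\<close> and \<open>X\<close>, the existence of such an \<open>e\<close> includes that
  the defining formula does not depend on the representatives.
\<close>

definition canonical_error ::
    "'g monoid \<Rightarrow> ('m::topological_space, 'b::real_normed_vector) atlas \<Rightarrow>
     ('g \<Rightarrow> 'm \<Rightarrow> 'm) \<Rightarrow> 'm \<Rightarrow> ('m \<Rightarrow> 'm \<Rightarrow> 'm) \<Rightarrow> bool" where
  "canonical_error G B h y0 e \<longleftrightarrow>
     (\<forall>Xh X. e (h Xh y0) (h X y0) = h (Xh \<otimes>\<^bsub>G\<^esub> inv\<^bsub>G\<^esub> X) y0) \<and>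
     smooth_map (prod_atlas B B) B (\<lambda>(xh, x). e xh x)"

text \<open>\<open>d/dt e = F(e)\<close> along all solutions of the projected system and the observer\<close>

definition has_error_dynamics ::
    "'g::topological_space monoid \<Rightarrow> ('g, 'a::real_normed_vector) atlas \<Rightarrow>
     ('m::topological_space, 'b::real_normed_vector) atlas \<Rightarrow>
     ('g \<Rightarrow> 'm \<Rightarrow> 'm) \<Rightarrow> 'm \<Rightarrow> ('g, 'a, 'm, 'b) innov \<Rightarrow> ('m \<Rightarrow> 'm \<Rightarrow> 'm) \<Rightarrow>
     ('m \<Rightarrow> ('m, 'b) tvec) \<Rightarrow> bool" where
  "has_error_dynamics G A B h y0 \<alpha> e F \<longleftrightarrow>
     (\<forall>x. F x \<in> tangent_space B x) \<and>
     (\<forall>u y I yh. admissible G A u \<and> proj_solution G A B h y0 u y \<and>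
                 obs_solution G A B h y0 \<alpha> u y I yh \<longrightarrow>
        (\<forall>t\<in>I. has_velocity B (\<lambda>s. e (yh s) (y s)) (F (e (yh t) (y t))) t))"

definition autonomous_error ::
    "'g::topological_space monoid \<Rightarrow> ('g, 'a::real_normed_vector) atlas \<Rightarrow>
     ('m::topological_space, 'b::real_normed_vector) atlas \<Rightarrow>
     ('g \<Rightarrow> 'm \<Rightarrow> 'm) \<Rightarrow> 'm \<Rightarrow> ('g, 'a, 'm, 'b) innov \<Rightarrow> ('m \<Rightarrow> 'm \<Rightarrow> 'm) \<Rightarrow> bool" where
  "autonomous_error G A B h y0 \<alpha> e \<longleftrightarrow> (\<exists>F. has_error_dynamics G A B h y0 \<alpha> e F)"

end

theory Submission
  imports Defs
begin

text \<open>
  The canonical error is invariant under the simultaneous action of \<open>G\<close> on its two arguments, since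
  \<open>(XY)(ZY)\<^sup>-\<^sup>1 = XZ\<^sup>-\<^sup>1\<close>. The right-hand side of the projected system is the infinitesimal action: at
  \<open>y\<close> it is \<open>T\<^sub>e(Y \<mapsto> h(Y, y)) u\<close>. Differentiating \<open>e(h(Y, yh), h(Y, y)) = e(yh, y)\<close> in \<open>Y\<close> therefore
  shows that the copies of this field in the observer and in the system contribute nothing to the
  derivative of the error. What is left is the innovation, seen through \<open>z \<mapsto> e(z, y)\<close>, and for
  \<open>y = h(X, y0)\<close> this map is the translation by \<open>X\<^sup>-\<^sup>1\<close>. So along all solutions (lemma
  \<open>error_velocity\<close>)
  \<open>d/dt e(yh, y) = T h\<^sub>Z \<alpha>(yh, u, y, t)\<close> with \<open>Z = X\<^sup>-\<^sup>1\<close>, \<open>h(X, y0) = y\<close>.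

  If \<open>\<alpha>\<close> is equivariant and independent of \<open>u\<close> and \<open>t\<close>, the right-hand side is
  \<open>\<alpha>(h\<^sub>Z yh, h\<^sub>Z y) = \<alpha>(e, y0)\<close>. Conversely, if it equals \<open>F(e)\<close>, applying \<open>T h\<^sub>X\<close> gives
  \<open>\<alpha>(yh, u, y, t) = T h\<^sub>X F(h\<^sub>Z yh)\<close>, an expression without \<open>u\<close> and \<open>t\<close> that is visibly equivariant
  (lemmas \<open>innovation_eq_if_error_dynamics\<close> and \<open>equivariant_if_error_dynamics\<close>).

  The converse needs every quadruple \<open>(yh, u, y, t)\<close> to occur along solutions, hence for every \<open>u0\<close>
  and \<open>t0\<close> a continuous admissible input with value \<open>u0\<close> at \<open>t0\<close> (lemma \<open>admissible_input_through\<close>).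
  Instead of solving the equation for a prescribed input, one prescribes a solution: take any
  explicit curve \<open>X\<close> in \<open>G\<close> that passes the identity with velocity \<open>u0\<close> at time \<open>t0\<close> and let the input
  be its logarithmic derivative \<open>X\<^sup>-\<^sup>1 X'\<close>. The left translates of \<open>X\<close> are then solutions for
  all initial values. They are the only ones, because for two solutions \<open>Z\<close> and \<open>X\<close> the quotient
  \<open>Z X\<^sup>-\<^sup>1\<close> has velocity zero, by the same invariance argument as for the error.
\<close>

section \<open>Charts and pointwise differentiability\<close>

text \<open>
  First-order calculus at a single point. Unlike smoothness, this property passes to compositions by
  the ordinary chain rule alone.
\<close>

definition mdiff_at ::
    "('m::t2_space, 'b::real_normed_vector) atlas \<Rightarrow>
     ('n::t2_space, 'c::real_normed_vector) atlas \<Rightarrow> ('m \<Rightarrow> 'n) \<Rightarrow> 'm \<Rightarrow> bool" where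
  "mdiff_at A B f p \<longleftrightarrow> isCont f p \<and>
     (\<forall>(U, \<phi>)\<in>A. \<forall>(V, \<psi>)\<in>B. p \<in> U \<longrightarrow> f p \<in> V \<longrightarrow>
        (\<psi> \<circ> f \<circ> inv_into U \<phi>) differentiable (at (\<phi> p)))"

lemma smooth_on_differentiable:
  assumes "smooth_on S f" "x \<in> S"
  shows "f differentiable (at x)"
proof -
  have "Ck_on (Suc 0) S f" using assms(1) unfolding smooth_on_def by blast
  then show ?thesis using assms(2) by simp
qed

lemma smooth_on_continuous_derivative:
  assumes "smooth_on S f"
  shows "continuous_on S (\<lambda>x. frechet_derivative f (at x) v)"
proof -
  have "Ck_on (Suc 0) S f" using assms(1) unfolding smooth_on_def by blast
  then show ?thesis by simp
qed

lemma smooth_map_mdiff_at: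
  assumes "smooth_map A B f"
  shows "mdiff_at A B f p"
proof -
  have "isCont f p"
    using assms unfolding smooth_map_def by (simp add: continuous_on_eq_continuous_at)
  moreover have "(\<psi> \<circ> f \<circ> inv_into U \<phi>) differentiable (at (\<phi> p))"
    if "(U, \<phi>) \<in> A" "(V, \<psi>) \<in> B" "p \<in> U" "f p \<in> V" for U \<phi> V \<psi>
  proof -
    have "smooth_on (\<phi> ` (U \<inter> f -` V)) (\<psi> \<circ> f \<circ> inv_into U \<phi>)"
      using assms that unfolding smooth_map_def by blast
    then show ?thesis using that by (intro smooth_on_differentiable) auto
  qed
  ultimately show ?thesis unfolding mdiff_at_def by blast
qed

lemma smooth_manifold_chart:
  assumes "smooth_manifold A" "(U, \<phi>) \<in> A"
  shows "open U" "inj_on \<phi> U" "open (\<phi> ` U)" "continuous_on U \<phi>"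
    "continuous_on (\<phi> ` U) (inv_into U \<phi>)"
proof -
  have "is_chart (U, \<phi>)" using assms unfolding smooth_manifold_def by blast
  then have *: "open U" "open (\<phi> ` U)" "homeomorphism U (\<phi> ` U) \<phi> (inv_into U \<phi>)"
    unfolding is_chart_def by auto
  show "open U" "open (\<phi> ` U)" by fact+
  show "continuous_on U \<phi>" "continuous_on (\<phi> ` U) (inv_into U \<phi>)"
    using *(3) unfolding homeomorphism_def by auto
  show "inj_on \<phi> U"
    using *(3) unfolding homeomorphism_def by (metis inj_on_def)
qed

lemma smooth_manifold_chart_cont:
  assumes "smooth_manifold A" "(U, \<phi>) \<in> A" "p \<in> U"
  shows "isCont (inv_into U \<phi>) (\<phi> p)" "inv_into U \<phi> (\<phi> p) = p"
proof -
  note c = smooth_manifold_chart[OF assms(1,2)]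
  show "isCont (inv_into U \<phi>) (\<phi> p)"
    using c(3,5) assms(3) by (simp add: continuous_on_eq_continuous_at)
  show "inv_into U \<phi> (\<phi> p) = p" using c(2) assms(3) by simp
qed

lemma smooth_manifold_obtain_chart:
  assumes "smooth_manifold A"
  obtains U \<phi> where "(U, \<phi>) \<in> A" "p \<in> U"
proof -
  have "(\<Union>(U, \<phi>)\<in>A. U) = UNIV"
    using assms unfolding smooth_manifold_def by blast
  then have "p \<in> (\<Union>(U, \<phi>)\<in>A. U)" by simp
  then show ?thesis using that by auto
qed

lemma mdiff_at_id:
  assumes "smooth_manifold A"
  shows "mdiff_at A A id p"
proof -
  have "(\<psi> \<circ> inv_into U \<phi>) differentiable (at (\<phi> p))"
    if "(U, \<phi>) \<in> A" "(V, \<psi>) \<in> A" "p \<in> U" "p \<in> V" for U \<phi> V \<psi>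
  proof -
    have "smooth_on (\<phi> ` (U \<inter> V)) (\<psi> \<circ> inv_into U \<phi>)"
      using assms that unfolding smooth_manifold_def by blast
    then show ?thesis using that by (intro smooth_on_differentiable) auto
  qed
  then show ?thesis unfolding mdiff_at_def by (auto simp: id_def[symmetric])
qed

lemma mdiff_at_has_derivative:
  assumes "mdiff_at A B f p" "(U, \<phi>) \<in> A" "p \<in> U" "(V, \<psi>) \<in> B" "f p \<in> V"
  shows "((\<psi> \<circ> f \<circ> inv_into U \<phi>) has_derivative
            frechet_derivative (\<psi> \<circ> f \<circ> inv_into U \<phi>) (at (\<phi> p))) (at (\<phi> p))"
  using assms unfolding mdiff_at_def by (subst frechet_derivative_works[symmetric]) blast

lemma mdiff_at_isCont: "mdiff_at A B f p \<Longrightarrow> isCont f p"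
  unfolding mdiff_at_def by blast

lemma mdiff_at_isCont_coord:
  assumes A: "smooth_manifold A" and f: "mdiff_at A B f p" and U: "(U, \<phi>) \<in> A" "p \<in> U"
  shows "isCont (\<lambda>x. f (inv_into U \<phi> x)) (\<phi> p)"
proof -
  note cu = smooth_manifold_chart_cont[OF A U]
  show ?thesis using isCont_o2[OF cu(1), of f] mdiff_at_isCont[OF f] cu(2) by simp
qed

text \<open>
  The chain rule behind all the tangent map rules below. The parameter \<open>c\<close> ranges over an arbitrary
  normed space, so that \<open>c\<close> can be a curve as well as the inverse of a chart; the chart \<open>(U, \<phi>)\<close>
  need only be open and injective, so that it also applies to product charts.
\<close>

lemma coord_chain:
  assumes "mdiff_at A B f (c z)" "(U, \<phi>) \<in> A" "open U" "inj_on \<phi> U" "c z \<in> U"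
    and "(V, \<psi>) \<in> B" "f (c z) \<in> V" "isCont c z" "((\<lambda>x. \<phi> (c x)) has_derivative L) (at z)"
  shows "((\<lambda>x. \<psi> (f (c x))) has_derivative
            (\<lambda>d. frechet_derivative (\<psi> \<circ> f \<circ> inv_into U \<phi>) (at (\<phi> (c z))) (L d))) (at z)"
proof -
  let ?g = "\<psi> \<circ> f \<circ> inv_into U \<phi>"
  have "(?g has_derivative frechet_derivative ?g (at (\<phi> (c z)))) (at (\<phi> (c z)))"
    by (rule mdiff_at_has_derivative[OF assms(1,2,5,6,7)])
  from has_derivative_compose[OF assms(9) this]
  have D: "((\<lambda>x. ?g (\<phi> (c x))) has_derivative
            (\<lambda>d. frechet_derivative ?g (at (\<phi> (c z))) (L d))) (at z)" .
  have "\<forall>\<^sub>F x in at z. c x \<in> U"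
    using assms(3,5,8) by (simp add: isCont_def topological_tendstoD)
  then have "\<forall>\<^sub>F x in at z. ?g (\<phi> (c x)) = \<psi> (f (c x))"
    by eventually_elim (simp add: assms(4))
  from has_derivative_transform_eventually[OF D this] show ?thesis
    using assms(4,5) by simp
qed

lemma mdiff_at_compose:
  assumes "smooth_manifold A" "smooth_manifold B" "mdiff_at A B f p" "mdiff_at B C g (f p)"
  shows "mdiff_at A C (g \<circ> f) p"
proof -
  have "isCont (g \<circ> f) p"
    using assms(3,4) unfolding mdiff_at_def by (auto intro: continuous_at_compose)
  moreover have "(\<psi> \<circ> (g \<circ> f) \<circ> inv_into U \<phi>) differentiable (at (\<phi> p))"
    if h: "(U, \<phi>) \<in> A" "(W, \<psi>) \<in> C" "p \<in> U" "(g \<circ> f) p \<in> W" for U \<phi> W \<psi>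
  proof -
    obtain V \<eta> where V: "(V, \<eta>) \<in> B" "f p \<in> V"
      using smooth_manifold_obtain_chart[OF assms(2)] by metis
    note cu = smooth_manifold_chart_cont[OF assms(1) h(1,3)]
    note cv = smooth_manifold_chart[OF assms(2) V(1)]
    have "isCont (\<lambda>x. f (inv_into U \<phi> x)) (\<phi> p)"
      by (rule mdiff_at_isCont_coord[OF assms(1,3) h(1,3)])
    moreover have "((\<lambda>x. \<eta> (f (inv_into U \<phi> x))) has_derivative
        frechet_derivative (\<eta> \<circ> f \<circ> inv_into U \<phi>) (at (\<phi> p))) (at (\<phi> p))"
      using mdiff_at_has_derivative[OF assms(3) h(1,3) V] by (simp add: o_def)
    ultimately have "\<exists>L. ((\<lambda>x. \<psi> (g (f (inv_into U \<phi> x)))) has_derivative L) (at (\<phi> p))"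
      using coord_chain[of B C g "\<lambda>x. f (inv_into U \<phi> x)" "\<phi> p" V \<eta> W \<psi>]
        cu cv V h(2,4) assms(4) by auto
    then show ?thesis unfolding differentiable_def by (simp add: o_def)
  qed
  ultimately show ?thesis unfolding mdiff_at_def by blast
qed

section \<open>Tangent maps and velocities\<close>

lemma tangent_space_transition:
  assumes "v \<in> tangent_space A p" "(U, \<phi>) \<in> A" "(V, \<psi>) \<in> A" "p \<in> U" "p \<in> V"
  shows "v (V, \<psi>) = frechet_derivative (\<psi> \<circ> inv_into U \<phi>) (at (\<phi> p)) (v (U, \<phi>))"
  using assms unfolding tangent_space_def by blast

lemma tangent_space_outside:
  assumes "v \<in> tangent_space A p" "(U, \<phi>) \<notin> A \<or> p \<notin> U"
  shows "v (U, \<phi>) = 0"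
  using assms unfolding tangent_space_def by blast

lemma some_chart:
  assumes "smooth_manifold A"
  obtains U \<phi> where "(SOME c. c \<in> A \<and> p \<in> fst c) = (U, \<phi>)" "(U, \<phi>) \<in> A" "p \<in> U"
proof -
  obtain U \<phi> where "(U, \<phi>) \<in> A" "p \<in> U" using smooth_manifold_obtain_chart[OF assms] .
  then have "\<exists>c. c \<in> A \<and> p \<in> fst c" by force
  from someI_ex[OF this] show ?thesis
    using that[of "fst (SOME c. c \<in> A \<and> p \<in> fst c)" "snd (SOME c. c \<in> A \<and> p \<in> fst c)"] by simp
qed

lemma tmap_outside: "(V, \<psi>) \<notin> B \<or> f p \<notin> V \<Longrightarrow> tmap A B f p v (V, \<psi>) = 0"
  unfolding tmap_def by auto

text \<open>Replaces the chart chosen inside \<open>tmap\<close> by any other one, as the transition rule permits.\<close>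

lemma tmap_chart:
  assumes A: "smooth_manifold A" and f: "mdiff_at A B f p" and v: "v \<in> tangent_space A p"
    and U: "(U, \<phi>) \<in> A" "p \<in> U" and V: "(V, \<psi>) \<in> B" "f p \<in> V"
  shows "tmap A B f p v (V, \<psi>) =
           frechet_derivative (\<psi> \<circ> f \<circ> inv_into U \<phi>) (at (\<phi> p)) (v (U, \<phi>))"
proof -
  obtain U' \<phi>' where s: "(SOME c. c \<in> A \<and> p \<in> fst c) = (U', \<phi>')"
    and U': "(U', \<phi>') \<in> A" "p \<in> U'" using some_chart[OF A] .
  note cu = smooth_manifold_chart_cont[OF A U]
  note cu' = smooth_manifold_chart[OF A U'(1)]
  have "((\<lambda>x. \<phi>' (inv_into U \<phi> x)) has_derivative
          frechet_derivative (\<phi>' \<circ> inv_into U \<phi>) (at (\<phi> p))) (at (\<phi> p))"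
    using mdiff_at_has_derivative[OF mdiff_at_id[OF A] U U'(1)] U'(2) by (simp add: o_def)
  then have "((\<lambda>x. \<psi> (f (inv_into U \<phi> x))) has_derivative
      (\<lambda>d. frechet_derivative (\<psi> \<circ> f \<circ> inv_into U' \<phi>') (at (\<phi>' p))
         (frechet_derivative (\<phi>' \<circ> inv_into U \<phi>) (at (\<phi> p)) d))) (at (\<phi> p))"
    using coord_chain[of A B f "inv_into U \<phi>" "\<phi> p" U' \<phi>' V \<psi>] f cu cu' U' V by simp
  from frechet_derivative_at[OF this]
  have "frechet_derivative (\<psi> \<circ> f \<circ> inv_into U \<phi>) (at (\<phi> p)) (v (U, \<phi>)) =
      frechet_derivative (\<psi> \<circ> f \<circ> inv_into U' \<phi>') (at (\<phi>' p)) (v (U', \<phi>'))"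
    using tangent_space_transition[OF v U(1) U'(1) U(2) U'(2)]
    by (simp add: o_def fun_eq_iff)
  then show ?thesis unfolding tmap_def using V by (simp add: s)
qed

lemma tvec_eqI:
  fixes v w :: "('m, 'b) tvec"
  assumes "\<And>U \<phi>. v (U, \<phi>) = w (U, \<phi>)"
  shows "v = w"
  using assms by (auto simp: fun_eq_iff)

lemma tangent_space_eqI:
  assumes "v \<in> tangent_space A p" "w \<in> tangent_space A p"
    and "\<And>U \<phi>. (U, \<phi>) \<in> A \<Longrightarrow> p \<in> U \<Longrightarrow> v (U, \<phi>) = w (U, \<phi>)"
  shows "v = w"
proof (rule tvec_eqI)
  fix U \<phi>
  show "v (U, \<phi>) = w (U, \<phi>)"
    using assms tangent_space_outside[of v A p U \<phi>] tangent_space_outside[of w A p U \<phi>]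
    by metis
qed

text \<open>
  Both sides select the same charts at \<open>p\<close> and \<open>f p\<close>, so this is the ordinary chain rule in those
  charts, for arbitrary functions \<open>v\<close>.
\<close>

lemma tmap_compose:
  assumes A: "smooth_manifold A" and B: "smooth_manifold B"
    and f: "mdiff_at A B f p" and g: "mdiff_at B C g (f p)"
  shows "tmap A C (g \<circ> f) p v = tmap B C g (f p) (tmap A B f p v)"
proof (rule tvec_eqI)
  fix W \<psi>
  show "tmap A C (g \<circ> f) p v (W, \<psi>) = tmap B C g (f p) (tmap A B f p v) (W, \<psi>)"
  proof (cases "(W, \<psi>) \<in> C \<and> g (f p) \<in> W")
    case False
    then show ?thesis unfolding tmap_def by auto
  next
    case True
    obtain U \<phi> where s: "(SOME c. c \<in> A \<and> p \<in> fst c) = (U, \<phi>)"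
      and U: "(U, \<phi>) \<in> A" "p \<in> U" using some_chart[OF A] .
    obtain V \<eta> where s': "(SOME c. c \<in> B \<and> f p \<in> fst c) = (V, \<eta>)"
      and V: "(V, \<eta>) \<in> B" "f p \<in> V" using some_chart[OF B] .
    note cu = smooth_manifold_chart_cont[OF A U]
    note cv = smooth_manifold_chart[OF B V(1)]
    have "isCont (\<lambda>x. f (inv_into U \<phi> x)) (\<phi> p)"
      by (rule mdiff_at_isCont_coord[OF A f U])
    moreover have "((\<lambda>x. \<eta> (f (inv_into U \<phi> x))) has_derivative
        frechet_derivative (\<eta> \<circ> f \<circ> inv_into U \<phi>) (at (\<phi> p))) (at (\<phi> p))"
      using mdiff_at_has_derivative[OF f U V] by (simp add: o_def)
    ultimately have "((\<lambda>x. \<psi> (g (f (inv_into U \<phi> x)))) has_derivative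
      (\<lambda>d. frechet_derivative (\<psi> \<circ> g \<circ> inv_into V \<eta>) (at (\<eta> (f p)))
         (frechet_derivative (\<eta> \<circ> f \<circ> inv_into U \<phi>) (at (\<phi> p)) d))) (at (\<phi> p))"
      using coord_chain[of B C g "\<lambda>x. f (inv_into U \<phi> x)" "\<phi> p" V \<eta> W \<psi>]
        cu cv V True g by simp
    from frechet_derivative_at[OF this] show ?thesis
      unfolding tmap_def using True V by (simp add: s s' o_def fun_eq_iff)
  qed
qed

lemma tmap_in_tangent_space:
  assumes A: "smooth_manifold A" and B: "smooth_manifold B" and f: "mdiff_at A B f p"
  shows "tmap A B f p v \<in> tangent_space B (f p)"
proof -
  have "tmap A B f p v (W, \<psi>) =
      frechet_derivative (\<psi> \<circ> inv_into V \<eta>) (at (\<eta> (f p))) (tmap A B f p v (V, \<eta>))"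
    if V: "(V, \<eta>) \<in> B" "f p \<in> V" and W: "(W, \<psi>) \<in> B" "f p \<in> W" for V \<eta> W \<psi>
  proof -
    obtain U \<phi> where s: "(SOME c. c \<in> A \<and> p \<in> fst c) = (U, \<phi>)"
      and U: "(U, \<phi>) \<in> A" "p \<in> U" using some_chart[OF A] .
    note cu = smooth_manifold_chart_cont[OF A U]
    note cv = smooth_manifold_chart[OF B V(1)]
    have "isCont (\<lambda>x. f (inv_into U \<phi> x)) (\<phi> p)"
      by (rule mdiff_at_isCont_coord[OF A f U])
    moreover have "((\<lambda>x. \<eta> (f (inv_into U \<phi> x))) has_derivative
        frechet_derivative (\<eta> \<circ> f \<circ> inv_into U \<phi>) (at (\<phi> p))) (at (\<phi> p))"
      using mdiff_at_has_derivative[OF f U V] by (simp add: o_def)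
    ultimately have "((\<lambda>x. \<psi> (f (inv_into U \<phi> x))) has_derivative
      (\<lambda>d. frechet_derivative (\<psi> \<circ> inv_into V \<eta>) (at (\<eta> (f p)))
         (frechet_derivative (\<eta> \<circ> f \<circ> inv_into U \<phi>) (at (\<phi> p)) d))) (at (\<phi> p))"
      using coord_chain[of B B id "\<lambda>x. f (inv_into U \<phi> x)" "\<phi> p" V \<eta> W \<psi>]
        cu cv V W mdiff_at_id[OF B] by simp
    from frechet_derivative_at[OF this] show ?thesis
      unfolding tmap_def using V W by (simp add: s o_def fun_eq_iff)
  qed
  then show ?thesis unfolding tangent_space_def using tmap_outside[of _ _ B f p A v] by blast
qed

lemma tmap_id:
  assumes A: "smooth_manifold A" and v: "v \<in> tangent_space A p"
  shows "tmap A A id p v = v"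
proof (rule tangent_space_eqI)
  show "tmap A A id p v \<in> tangent_space A p"
    using tmap_in_tangent_space[OF A A mdiff_at_id[OF A], of p v] by simp
  fix V \<psi> assume "(V, \<psi>) \<in> A" "p \<in> V"
  note V = this
  have "tmap A A id p v (V, \<psi>) = frechet_derivative (\<psi> \<circ> inv_into V \<psi>) (at (\<psi> p)) (v (V, \<psi>))"
    using tmap_chart[OF A mdiff_at_id[OF A] v V V(1)] V(2) by simp
  also have "\<dots> = v (V, \<psi>)"
    by (rule tangent_space_transition[OF v V(1) V(1) V(2) V(2), symmetric])
  finally show "tmap A A id p v (V, \<psi>) = v (V, \<psi>)" .
qed (fact v)

lemma tmap_const: "tmap A B (\<lambda>_. q) p v = (\<lambda>_. 0)"
proof
  fix c show "tmap A B (\<lambda>_. q) p v c = 0"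
    by (cases c; cases "SOME c. c \<in> A \<and> p \<in> fst c") (auto simp: tmap_def o_def)
qed

lemma tmap_add:
  assumes A: "smooth_manifold A" and f: "mdiff_at A B f p"
  shows "tmap A B f p (\<lambda>c. v c + w c) = (\<lambda>c. tmap A B f p v c + tmap A B f p w c)"
proof (rule tvec_eqI)
  fix V \<psi>
  obtain U \<phi> where s: "(SOME c. c \<in> A \<and> p \<in> fst c) = (U, \<phi>)"
    and U: "(U, \<phi>) \<in> A" "p \<in> U" using some_chart[OF A] .
  show "tmap A B f p (\<lambda>c. v c + w c) (V, \<psi>) = tmap A B f p v (V, \<psi>) + tmap A B f p w (V, \<psi>)"
  proof (cases "(V, \<psi>) \<in> B \<and> f p \<in> V")
    case True
    then have "linear (frechet_derivative (\<psi> \<circ> f \<circ> inv_into U \<phi>) (at (\<phi> p)))"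
      using mdiff_at_has_derivative[OF f U] has_derivative_linear by blast
    then show ?thesis unfolding tmap_def by (simp add: s linear_add)
  qed (auto simp: tmap_def)
qed

lemma tangent_space_add:
  assumes A: "smooth_manifold A" and v: "v \<in> tangent_space A p" and w: "w \<in> tangent_space A p"
  shows "(\<lambda>c. v c + w c) \<in> tangent_space A p"
proof -
  have "tmap A A id p (\<lambda>c. v c + w c) = (\<lambda>c. v c + w c)"
    using tmap_add[OF A mdiff_at_id[OF A], of p v w] tmap_id[OF A] v w by simp
  then show ?thesis using tmap_in_tangent_space[OF A A mdiff_at_id[OF A], of p "\<lambda>c. v c + w c"] by simp
qed

lemma has_velocity_unique:
  assumes "has_velocity A c v t" "has_velocity A c w t"
  shows "v = w"
proof (rule tangent_space_eqI[of _ A "c t"])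
  fix U \<phi> assume "(U, \<phi>) \<in> A" "c t \<in> U"
  then show "v (U, \<phi>) = w (U, \<phi>)"
    using assms unfolding has_velocity_def
    by (intro vector_derivative_unique_at[of "\<lambda>s. \<phi> (c s)"]) auto
qed (use assms in \<open>auto simp: has_velocity_def\<close>)

lemma has_velocity_map:
  assumes A: "smooth_manifold A" and B: "smooth_manifold B"
    and c: "has_velocity A c v t" and f: "mdiff_at A B f (c t)"
  shows "has_velocity B (\<lambda>s. f (c s)) (tmap A B f (c t) v) t"
  unfolding has_velocity_def
proof (intro conjI ballI impI, safe)
  have v: "v \<in> tangent_space A (c t)" and cc: "isCont c t" using c unfolding has_velocity_def by auto
  show "tmap A B f (c t) v \<in> tangent_space B (f (c t))" by (rule tmap_in_tangent_space[OF A B f])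
  show "isCont (\<lambda>s. f (c s)) t" by (rule isCont_o2[OF cc mdiff_at_isCont[OF f]])
  fix V \<psi> assume V: "(V, \<psi>) \<in> B" "f (c t) \<in> V"
  obtain U \<phi> where U: "(U, \<phi>) \<in> A" "c t \<in> U" using smooth_manifold_obtain_chart[OF A] .
  note cu = smooth_manifold_chart[OF A U(1)]
  let ?D = "frechet_derivative (\<psi> \<circ> f \<circ> inv_into U \<phi>) (at (\<phi> (c t)))"
  have "((\<lambda>s. \<phi> (c s)) has_derivative (\<lambda>r. r *\<^sub>R v (U, \<phi>))) (at t)"
    using c U unfolding has_velocity_def has_vector_derivative_def by blast
  then have "((\<lambda>s. \<psi> (f (c s))) has_derivative (\<lambda>r. ?D (r *\<^sub>R v (U, \<phi>)))) (at t)"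
    by (rule coord_chain[OF f U(1) cu(1,2) U(2) V cc])
  moreover have "linear ?D"
    using mdiff_at_has_derivative[OF f U V] has_derivative_linear by blast
  ultimately show "((\<lambda>s. \<psi> (f (c s))) has_vector_derivative tmap A B f (c t) v (V, \<psi>)) (at t)"
    unfolding has_vector_derivative_def tmap_chart[OF A f v U V] by (simp add: linear_scale)
qed

text \<open>
  In charts the curve has derivative zero, so it is locally constant; the level set of \<open>c 0\<close> is then
  open as well as closed in the connected real line.
\<close>

lemma zero_velocity_constant:
  fixes c :: "real \<Rightarrow> 'm::{t2_space,second_countable_topology}"
  assumes A: "smooth_manifold A" and c: "\<And>t. has_velocity A c (\<lambda>_. 0) t"
  shows "c t = c 0"
proof -
  have cont: "continuous_on UNIV c"
    using c unfolding has_velocity_def by (simp add: continuous_on_eq_continuous_at)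
  have "closed {s. c s = c 0}"
    using closed_Collect_eq[OF cont continuous_on_const] .
  moreover have "open {s. c s = c 0}"
    unfolding open_contains_ball
  proof
    fix s assume s: "s \<in> {s. c s = c 0}"
    obtain U \<phi> where U: "(U, \<phi>) \<in> A" "c s \<in> U" using smooth_manifold_obtain_chart[OF A] .
    note cu = smooth_manifold_chart[OF A U(1)]
    have "open (c -` U)" using open_vimage[OF cu(1) cont] .
    then obtain r where r: "r > 0" "ball s r \<subseteq> c -` U"
      using U(2) openE[of "c -` U" s] by auto
    have "c x = c 0" if x: "x \<in> ball s r" for x
    proof -
      have "((\<lambda>s. \<phi> (c s)) has_derivative (\<lambda>h. 0)) (at y within ball s r)" if "y \<in> ball s r" for y
      proof -
        have "((\<lambda>s. \<phi> (c s)) has_vector_derivative 0) (at y)"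
          using c[of y] U(1) that r(2) unfolding has_velocity_def by blast
        then show ?thesis
          unfolding has_vector_derivative_def by (auto intro: has_derivative_at_withinI)
      qed
      from has_derivative_zero_unique[OF convex_ball this x, of s] r(1)
      have "\<phi> (c x) = \<phi> (c s)" by simp
      then have "c x = c s" using cu(2) r x U(2) unfolding inj_on_def by blast
      then show ?thesis using s by simp
    qed
    then show "\<exists>e>0. ball s e \<subseteq> {s. c s = c 0}" using r(1) by auto
  qed
  ultimately have "{s. c s = c 0} = UNIV"
    using clopen[of "{s. c s = c 0}"] by blast
  then show ?thesis by blast
qed

text \<open>
  To know a velocity it suffices to differentiate in one chart: the coordinates in the others are
  forced by the transition maps.
\<close>

lemma velocity_from_chart:
  assumes A: "smooth_manifold A" and U: "(U, \<phi>) \<in> A" "c t \<in> U" and c: "isCont c t"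
    and d: "((\<lambda>s. \<phi> (c s)) has_vector_derivative a) (at t)"
  obtains v where "has_velocity A c v t" "v (U, \<phi>) = a"
proof -
  note cu = smooth_manifold_chart[OF A U(1)] and cp = smooth_manifold_chart_cont[OF A U]
  note id = mdiff_at_has_derivative[OF mdiff_at_id[OF A] U, simplified]
  define v where "v = (\<lambda>(V, \<psi>). if (V, \<psi>) \<in> A \<and> c t \<in> V
      then frechet_derivative (\<psi> \<circ> inv_into U \<phi>) (at (\<phi> (c t))) a else 0)"
  have v: "v (V, \<psi>) = frechet_derivative (\<psi> \<circ> inv_into U \<phi>) (at (\<phi> (c t))) a"
    if "(V, \<psi>) \<in> A" "c t \<in> V" for V \<psi>
    using that unfolding v_def by simp
  have "v \<in> tangent_space A (c t)"
  proof -
    have "v (W, \<psi>) = frechet_derivative (\<psi> \<circ> inv_into V \<eta>) (at (\<eta> (c t))) (v (V, \<eta>))"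
      if V: "(V, \<eta>) \<in> A" "c t \<in> V" and W: "(W, \<psi>) \<in> A" "c t \<in> W" for V \<eta> W \<psi>
    proof -
      have "((\<lambda>x. \<eta> (inv_into U \<phi> x)) has_derivative
          frechet_derivative (\<eta> \<circ> inv_into U \<phi>) (at (\<phi> (c t)))) (at (\<phi> (c t)))"
        using id[OF V] by (simp add: o_def)
      then have "((\<lambda>x. \<psi> (inv_into U \<phi> x)) has_derivative
          (\<lambda>d. frechet_derivative (\<psi> \<circ> inv_into V \<eta>) (at (\<eta> (c t)))
             (frechet_derivative (\<eta> \<circ> inv_into U \<phi>) (at (\<phi> (c t))) d))) (at (\<phi> (c t)))"
        using coord_chain[of A A id "inv_into U \<phi>" "\<phi> (c t)" V \<eta> W \<psi>]
          smooth_manifold_chart[OF A V(1)] cp V W mdiff_at_id[OF A] by simp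
      from frechet_derivative_at[OF this] show ?thesis
        unfolding v[OF V] v[OF W] by (simp add: o_def fun_eq_iff)
    qed
    moreover have "v (V, \<eta>) = 0" if "(V, \<eta>) \<notin> A \<or> c t \<notin> V" for V \<eta>
      using that unfolding v_def by auto
    ultimately show ?thesis unfolding tangent_space_def by blast
  qed
  moreover have "((\<lambda>s. \<psi> (c s)) has_vector_derivative v (V, \<psi>)) (at t)"
    if V: "(V, \<psi>) \<in> A" "c t \<in> V" for V \<psi>
  proof -
    have "linear (frechet_derivative (\<psi> \<circ> inv_into U \<phi>) (at (\<phi> (c t))))"
      using id[OF V] has_derivative_linear by blast
    moreover have "((\<lambda>s. \<psi> (c s)) has_derivative
        (\<lambda>r. frechet_derivative (\<psi> \<circ> inv_into U \<phi>) (at (\<phi> (c t))) (r *\<^sub>R a))) (at t)"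
      using coord_chain[of A A id c t U \<phi> V \<psi>] mdiff_at_id[OF A] U V cu c d
      unfolding has_vector_derivative_def by simp
    ultimately show ?thesis
      unfolding has_vector_derivative_def v[OF V] by (simp add: linear_scale)
  qed
  ultimately have vel: "has_velocity A c v t" using c unfolding has_velocity_def by blast
  then have "((\<lambda>s. \<phi> (c s)) has_vector_derivative v (U, \<phi>)) (at t)"
    using U unfolding has_velocity_def by blast
  then have "v (U, \<phi>) = a" using d vector_derivative_unique_at by blast
  with vel show ?thesis by (rule that)
qed

text \<open>
  Any tangent vector is the velocity of a curve that is defined for all times and stays in one chart
  domain: a straight segment in coordinates, run through periodically so that it cannot leave the
  image of the chart. That the coordinate velocity is a continuous scalar multiple of a fixed vector
  makes the logarithmic derivative of such a curve continuous, because continuity of derivatives is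
  available in fixed directions only.
\<close>

lemma curve_through:
  assumes A: "smooth_manifold A" and v: "v \<in> tangent_space A p"
  obtains c w b U \<phi> where "(U, \<phi>) \<in> A" "\<And>t. c t \<in> U" "c t0 = p"
    "\<And>t. has_velocity A c (w t) t" "w t0 = v"
    "\<And>t. w t (U, \<phi>) = b t *\<^sub>R v (U, \<phi>)" "continuous_on UNIV (b :: real \<Rightarrow> real)"
proof -
  obtain U \<phi> where U: "(U, \<phi>) \<in> A" "p \<in> U" using smooth_manifold_obtain_chart[OF A] .
  note cu = smooth_manifold_chart[OF A U(1)]
  obtain r where r: "r > 0" "ball (\<phi> p) r \<subseteq> \<phi> ` U" using cu(3) U(2) openE[of "\<phi> ` U" "\<phi> p"] by auto
  let ?a = "v (U, \<phi>)"
  \<comment> \<open>the amplitude \<open>d\<close> keeps the oscillation inside the ball, the frequency \<open>1/d\<close> makes the velocity at \<open>t0\<close> exactly \<open>?a\<close>\<close>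
  define d where "d = r / (norm ?a + 1)"
  have d: "d > 0" "d * norm ?a < r"
    using r(1) by (auto simp: d_def field_simps add_pos_nonneg intro: add_nonneg_pos)
  define g where "g = (\<lambda>t. \<phi> p + (d * sin ((t - t0) / d)) *\<^sub>R ?a)"
  have "norm ((d * sin ((t - t0) / d)) *\<^sub>R ?a) < r" for t
  proof -
    have "\<bar>sin ((t - t0) / d)\<bar> * (d * norm ?a) \<le> 1 * (d * norm ?a)"
      using d(1) by (intro mult_right_mono) auto
    also have "\<dots> < r" using d(2) by simp
    finally show ?thesis using d(1) by (simp add: abs_mult ac_simps del: mult_le_cancel_left1)
  qed
  then have gU: "g t \<in> \<phi> ` U" for t using r(2) unfolding g_def by (auto simp: dist_norm)
  define c where "c = (\<lambda>t. inv_into U \<phi> (g t))"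
  have cU: "c t \<in> U" and \<phi>c: "\<phi> (c t) = g t" for t
    unfolding c_def using gU[of t] by (auto intro: inv_into_into f_inv_into_f)
  have g': "(g has_vector_derivative cos ((t - t0) / d) *\<^sub>R ?a) (at t)" for t
    unfolding g_def has_vector_derivative_def using d(1)
    by (auto intro!: derivative_eq_intros simp: fun_eq_iff)
  have cc: "isCont c t" for t
  proof -
    have 1: "isCont g t" using g'[of t] has_vector_derivative_continuous by blast
    have 2: "isCont (inv_into U \<phi>) (g t)"
      using smooth_manifold_chart_cont(1)[OF A U(1) cU[of t]] unfolding \<phi>c .
    show ?thesis unfolding c_def by (rule isCont_o2[OF 1 2])
  qed
  have "\<exists>w. has_velocity A c w t \<and> w (U, \<phi>) = cos ((t - t0) / d) *\<^sub>R ?a" for t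
    using velocity_from_chart[OF A U(1) cU[of t] cc[of t], of "cos ((t - t0) / d) *\<^sub>R ?a"] g'[of t]
    unfolding \<phi>c by metis
  then obtain w where w: "\<And>t. has_velocity A c (w t) t"
    "\<And>t. w t (U, \<phi>) = cos ((t - t0) / d) *\<^sub>R ?a" by metis
  have ct0: "c t0 = p" unfolding c_def g_def using cu(2) U(2) by simp
  have wt: "w t0 \<in> tangent_space A p" using w(1)[of t0] ct0 unfolding has_velocity_def by simp
  have "w t0 = v"
  proof (rule tangent_space_eqI[OF wt v])
    fix V \<psi> assume V: "(V, \<psi>) \<in> A" "p \<in> V"
    show "w t0 (V, \<psi>) = v (V, \<psi>)"
      using tangent_space_transition[OF wt U(1) V(1) U(2) V(2)]
        tangent_space_transition[OF v U(1) V(1) U(2) V(2)] w(2)[of t0] by simp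
  qed
  moreover have "continuous_on UNIV (\<lambda>t. cos ((t - t0) / d))"
    using d(1) by (intro continuous_intros) auto
  ultimately show ?thesis using that[OF U(1) cU ct0 w(1) _ w(2)] by blast
qed

section \<open>Maps of two arguments\<close>

text \<open>
  Tangent vectors of a product manifold are avoided altogether: a map of two arguments is
  differentiated through its two partial tangent maps. The lemma \<open>coord_chain2\<close> is the chain rule in
  a product chart; \<open>partial_derivatives\<close> then identifies the two halves of the total derivative by
  freezing one argument.
\<close>

lemma coord_chain2:
  assumes E: "mdiff_at (prod_atlas B C) D (\<lambda>(x, y). E x y) (c1 z, c2 z)"
    and B: "smooth_manifold B" and C: "smooth_manifold C"
    and U: "(U, \<phi>) \<in> B" "c1 z \<in> U" and V: "(V, \<eta>) \<in> C" "c2 z \<in> V"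
    and W: "(W, \<psi>) \<in> D" "E (c1 z) (c2 z) \<in> W"
    and c1: "isCont c1 z" "((\<lambda>x. \<phi> (c1 x)) has_derivative L1) (at z)"
    and c2: "isCont c2 z" "((\<lambda>x. \<eta> (c2 x)) has_derivative L2) (at z)"
  shows "((\<lambda>x. \<psi> (E (c1 x) (c2 x))) has_derivative
           (\<lambda>d. frechet_derivative (\<psi> \<circ> (\<lambda>(x, y). E x y) \<circ> inv_into (U \<times> V) (map_prod \<phi> \<eta>))
                  (at (\<phi> (c1 z), \<eta> (c2 z))) (L1 d, L2 d))) (at z)"
proof -
  note cu = smooth_manifold_chart[OF B U(1)]
  note cv = smooth_manifold_chart[OF C V(1)]
  have 1: "(U \<times> V, map_prod \<phi> \<eta>) \<in> prod_atlas B C"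
    using U V unfolding prod_atlas_def by blast
  have 2: "inj_on (map_prod \<phi> \<eta>) (U \<times> V)" using cu cv map_prod_inj_on by blast
  have 3: "isCont (\<lambda>x. (c1 x, c2 x)) z" using c1 c2 by (auto simp: isCont_def intro: tendsto_Pair)
  have 4: "((\<lambda>x. map_prod \<phi> \<eta> (c1 x, c2 x)) has_derivative (\<lambda>d. (L1 d, L2 d))) (at z)"
    using has_derivative_Pair[OF c1(2) c2(2)] by simp
  show ?thesis
    using coord_chain[OF E 1 open_Times[OF cu(1) cv(1)] 2 _ W(1) _ 3 4] U V W by simp
qed

lemma partial_derivatives:
  assumes E: "mdiff_at (prod_atlas B C) D (\<lambda>(x, y). E x y) (p, q)"
    and B: "smooth_manifold B" and C: "smooth_manifold C"
    and U: "(U, \<phi>) \<in> B" "p \<in> U" and V: "(V, \<eta>) \<in> C" "q \<in> V"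
    and W: "(W, \<psi>) \<in> D" "E p q \<in> W"
  defines "M \<equiv> frechet_derivative (\<psi> \<circ> (\<lambda>(x, y). E x y) \<circ> inv_into (U \<times> V) (map_prod \<phi> \<eta>))
                  (at (\<phi> p, \<eta> q))"
  shows "((\<psi> \<circ> (\<lambda>x. E x q) \<circ> inv_into U \<phi>) has_derivative (\<lambda>a. M (a, 0))) (at (\<phi> p))"
    and "((\<psi> \<circ> (\<lambda>y. E p y) \<circ> inv_into V \<eta>) has_derivative (\<lambda>b. M (0, b))) (at (\<eta> q))"
proof -
  note pU = smooth_manifold_chart_cont[OF B U]
  note pV = smooth_manifold_chart_cont[OF C V]
  have idU: "((\<lambda>x. \<phi> (inv_into U \<phi> x)) has_derivative (\<lambda>d. d)) (at (\<phi> p))"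
    by (rule has_derivative_transform_within_open[OF has_derivative_ident
          smooth_manifold_chart(3)[OF B U(1)]]) (use U in \<open>auto simp: f_inv_into_f\<close>)
  have idV: "((\<lambda>x. \<eta> (inv_into V \<eta> x)) has_derivative (\<lambda>d. d)) (at (\<eta> q))"
    by (rule has_derivative_transform_within_open[OF has_derivative_ident
          smooth_manifold_chart(3)[OF C V(1)]]) (use V in \<open>auto simp: f_inv_into_f\<close>)
  show "((\<psi> \<circ> (\<lambda>x. E x q) \<circ> inv_into U \<phi>) has_derivative (\<lambda>a. M (a, 0))) (at (\<phi> p))"
    using coord_chain2[of B C D E "inv_into U \<phi>" "\<phi> p" "\<lambda>_. q" U \<phi> V \<eta> W \<psi> "\<lambda>d. d" "\<lambda>_. 0"]
      E B C U V W pU idU unfolding M_def by (simp add: o_def)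
  show "((\<psi> \<circ> (\<lambda>y. E p y) \<circ> inv_into V \<eta>) has_derivative (\<lambda>b. M (0, b))) (at (\<eta> q))"
    using coord_chain2[of B C D E "\<lambda>_. p" "\<eta> q" "inv_into V \<eta>" U \<phi> V \<eta> W \<psi> "\<lambda>_. 0" "\<lambda>d. d"]
      E B C U V W pV idV unfolding M_def by (simp add: o_def)
qed

lemma mdiff_at_partial:
  assumes E: "mdiff_at (prod_atlas B C) D (\<lambda>(x, y). E x y) (p, q)"
    and B: "smooth_manifold B" and C: "smooth_manifold C"
  shows "mdiff_at B D (\<lambda>x. E x q) p" "mdiff_at C D (\<lambda>y. E p y) q"
proof -
  obtain U \<phi> where U: "(U, \<phi>) \<in> B" "p \<in> U" using smooth_manifold_obtain_chart[OF B] .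
  obtain V \<eta> where V: "(V, \<eta>) \<in> C" "q \<in> V" using smooth_manifold_obtain_chart[OF C] .
  have cE: "isCont (\<lambda>(x, y). E x y) (p, q)" using E unfolding mdiff_at_def by blast
  have "isCont (\<lambda>x. (x, q)) p" "isCont (\<lambda>y. (p, y)) q"
    by (auto simp: isCont_def intro!: tendsto_Pair)
  from this[THEN isCont_o2[where g = "\<lambda>(x, y). E x y"]] cE
  have "isCont (\<lambda>x. E x q) p" "isCont (\<lambda>y. E p y) q" by auto
  moreover have "(\<psi> \<circ> (\<lambda>x. E x q) \<circ> inv_into U' \<phi>') differentiable (at (\<phi>' p))"
    if "(U', \<phi>') \<in> B" "(W, \<psi>) \<in> D" "p \<in> U'" "E p q \<in> W" for U' \<phi>' W \<psi>
    by (rule differentiableI, rule partial_derivatives(1)[OF E B C that(1,3) V that(2,4)])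
  moreover have "(\<psi> \<circ> (\<lambda>y. E p y) \<circ> inv_into V' \<eta>') differentiable (at (\<eta>' q))"
    if "(V', \<eta>') \<in> C" "(W, \<psi>) \<in> D" "q \<in> V'" "E p q \<in> W" for V' \<eta>' W \<psi>
    by (rule differentiableI, rule partial_derivatives(2)[OF E B C U that(1,3) that(2,4)])
  ultimately show "mdiff_at B D (\<lambda>x. E x q) p" "mdiff_at C D (\<lambda>y. E p y) q"
    unfolding mdiff_at_def by fast+
qed

lemma coord_chain2_split:
  assumes E: "mdiff_at (prod_atlas B C) D (\<lambda>(x, y). E x y) (c1 z, c2 z)"
    and B: "smooth_manifold B" and C: "smooth_manifold C"
    and U: "(U, \<phi>) \<in> B" "c1 z \<in> U" and V: "(V, \<eta>) \<in> C" "c2 z \<in> V"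
    and W: "(W, \<psi>) \<in> D" "E (c1 z) (c2 z) \<in> W"
    and c1: "isCont c1 z" "((\<lambda>x. \<phi> (c1 x)) has_derivative L1) (at z)"
    and c2: "isCont c2 z" "((\<lambda>x. \<eta> (c2 x)) has_derivative L2) (at z)"
  shows "((\<lambda>x. \<psi> (E (c1 x) (c2 x))) has_derivative
           (\<lambda>d. frechet_derivative (\<psi> \<circ> (\<lambda>x. E x (c2 z)) \<circ> inv_into U \<phi>) (at (\<phi> (c1 z))) (L1 d) +
                frechet_derivative (\<psi> \<circ> (\<lambda>y. E (c1 z) y) \<circ> inv_into V \<eta>) (at (\<eta> (c2 z))) (L2 d)))
         (at z)"
proof -
  define M where "M = frechet_derivative (\<psi> \<circ> (\<lambda>(x, y). E x y) \<circ> inv_into (U \<times> V) (map_prod \<phi> \<eta>))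
                  (at (\<phi> (c1 z), \<eta> (c2 z)))"
  note pd = partial_derivatives[OF E B C U V W, folded M_def]
  have "(U \<times> V, map_prod \<phi> \<eta>) \<in> prod_atlas B C"
    using U V unfolding prod_atlas_def by blast
  from mdiff_at_has_derivative[OF E this, of W \<psi>] have "linear M"
    using U V W unfolding M_def by (auto intro: has_derivative_linear)
  then have "M (L1 d, L2 d) = M (L1 d, 0) + M (0, L2 d)" for d
    using linear_add[of M "(L1 d, 0)" "(0, L2 d)"] by simp
  then show ?thesis
    using coord_chain2[OF E B C U V W c1 c2, folded M_def]
    by (simp add: frechet_derivative_at[OF pd(1), symmetric] frechet_derivative_at[OF pd(2), symmetric])
qed

lemma has_velocity_map2:
  assumes B: "smooth_manifold B" and C: "smooth_manifold C" and D: "smooth_manifold D"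
    and c1: "has_velocity B c1 v t" and c2: "has_velocity C c2 w t"
    and E: "mdiff_at (prod_atlas B C) D (\<lambda>(x, y). E x y) (c1 t, c2 t)"
  shows "has_velocity D (\<lambda>s. E (c1 s) (c2 s))
           (\<lambda>c. tmap B D (\<lambda>x. E x (c2 t)) (c1 t) v c + tmap C D (\<lambda>y. E (c1 t) y) (c2 t) w c) t"
  unfolding has_velocity_def
proof (intro conjI ballI impI, safe)
  have v: "v \<in> tangent_space B (c1 t)" and cc1: "isCont c1 t"
    and w: "w \<in> tangent_space C (c2 t)" and cc2: "isCont c2 t"
    using c1 c2 unfolding has_velocity_def by auto
  note dE = mdiff_at_partial[OF E B C]
  show "(\<lambda>c. tmap B D (\<lambda>x. E x (c2 t)) (c1 t) v c + tmap C D (\<lambda>y. E (c1 t) y) (c2 t) w c)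
      \<in> tangent_space D (E (c1 t) (c2 t))"
    using tangent_space_add[OF D] tmap_in_tangent_space[OF B D dE(1)]
      tmap_in_tangent_space[OF C D dE(2)] by blast
  have "isCont (\<lambda>s. (c1 s, c2 s)) t" using cc1 cc2 by (auto simp: isCont_def intro: tendsto_Pair)
  from isCont_o2[OF this, of "\<lambda>(x, y). E x y"] show "isCont (\<lambda>s. E (c1 s) (c2 s)) t"
    using E unfolding mdiff_at_def by simp
  fix W \<psi> assume W: "(W, \<psi>) \<in> D" "E (c1 t) (c2 t) \<in> W"
  obtain U \<phi> where U: "(U, \<phi>) \<in> B" "c1 t \<in> U" using smooth_manifold_obtain_chart[OF B] .
  obtain V \<eta> where V: "(V, \<eta>) \<in> C" "c2 t \<in> V" using smooth_manifold_obtain_chart[OF C] .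
  let ?D1 = "frechet_derivative (\<psi> \<circ> (\<lambda>x. E x (c2 t)) \<circ> inv_into U \<phi>) (at (\<phi> (c1 t)))"
  let ?D2 = "frechet_derivative (\<psi> \<circ> (\<lambda>y. E (c1 t) y) \<circ> inv_into V \<eta>) (at (\<eta> (c2 t)))"
  have "((\<lambda>s. \<phi> (c1 s)) has_derivative (\<lambda>r. r *\<^sub>R v (U, \<phi>))) (at t)"
    and "((\<lambda>s. \<eta> (c2 s)) has_derivative (\<lambda>r. r *\<^sub>R w (V, \<eta>))) (at t)"
    using c1 c2 U V unfolding has_velocity_def has_vector_derivative_def by blast+
  from coord_chain2_split[OF E B C U V W cc1 this(1) cc2 this(2)]
  have "((\<lambda>s. \<psi> (E (c1 s) (c2 s))) has_derivative
      (\<lambda>r. ?D1 (r *\<^sub>R v (U, \<phi>)) + ?D2 (r *\<^sub>R w (V, \<eta>)))) (at t)" .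
  moreover have "linear ?D1" "linear ?D2"
    using mdiff_at_has_derivative[OF dE(1) U W] mdiff_at_has_derivative[OF dE(2) V W]
      has_derivative_linear by blast+
  ultimately show "((\<lambda>s. \<psi> (E (c1 s) (c2 s))) has_vector_derivative
      tmap B D (\<lambda>x. E x (c2 t)) (c1 t) v (W, \<psi>) + tmap C D (\<lambda>y. E (c1 t) y) (c2 t) w (W, \<psi>)) (at t)"
    unfolding has_vector_derivative_def
      tmap_chart[OF B dE(1) v U W] tmap_chart[OF C dE(2) w V W]
    by (simp add: linear_scale scaleR_right_distrib)
qed

lemma tmap_map2:
  assumes A: "smooth_manifold A" and B: "smooth_manifold B" and C: "smooth_manifold C"
    and f: "mdiff_at A B f p" and g: "mdiff_at A C g p"
    and E: "mdiff_at (prod_atlas B C) D (\<lambda>(x, y). E x y) (f p, g p)"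
  shows "tmap A D (\<lambda>x. E (f x) (g x)) p v =
           (\<lambda>c. tmap B D (\<lambda>x. E x (g p)) (f p) (tmap A B f p v) c +
                tmap C D (\<lambda>y. E (f p) y) (g p) (tmap A C g p v) c)"
proof (rule tvec_eqI)
  fix W \<psi>
  show "tmap A D (\<lambda>x. E (f x) (g x)) p v (W, \<psi>) =
           tmap B D (\<lambda>x. E x (g p)) (f p) (tmap A B f p v) (W, \<psi>) +
           tmap C D (\<lambda>y. E (f p) y) (g p) (tmap A C g p v) (W, \<psi>)"
  proof (cases "(W, \<psi>) \<in> D \<and> E (f p) (g p) \<in> W")
    case False
    then show ?thesis unfolding tmap_def by auto
  next
    case True
    obtain Z \<zeta> where s: "(SOME c. c \<in> A \<and> p \<in> fst c) = (Z, \<zeta>)"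
      and Z: "(Z, \<zeta>) \<in> A" "p \<in> Z" using some_chart[OF A] .
    obtain U \<phi> where s1: "(SOME c. c \<in> B \<and> f p \<in> fst c) = (U, \<phi>)"
      and U: "(U, \<phi>) \<in> B" "f p \<in> U" using some_chart[OF B] .
    obtain V \<eta> where s2: "(SOME c. c \<in> C \<and> g p \<in> fst c) = (V, \<eta>)"
      and V: "(V, \<eta>) \<in> C" "g p \<in> V" using some_chart[OF C] .
    note cz = smooth_manifold_chart_cont[OF A Z]
    note 1 = mdiff_at_isCont_coord[OF A f Z] mdiff_at_isCont_coord[OF A g Z]
    have 2: "((\<lambda>x. \<phi> (f (inv_into Z \<zeta> x))) has_derivative
        frechet_derivative (\<phi> \<circ> f \<circ> inv_into Z \<zeta>) (at (\<zeta> p))) (at (\<zeta> p))"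
      "((\<lambda>x. \<eta> (g (inv_into Z \<zeta> x))) has_derivative
        frechet_derivative (\<eta> \<circ> g \<circ> inv_into Z \<zeta>) (at (\<zeta> p))) (at (\<zeta> p))"
      using mdiff_at_has_derivative[OF f Z U] mdiff_at_has_derivative[OF g Z V] by (simp_all add: o_def)
    have "((\<lambda>x. \<psi> (E (f (inv_into Z \<zeta> x)) (g (inv_into Z \<zeta> x)))) has_derivative
      (\<lambda>d. frechet_derivative (\<psi> \<circ> (\<lambda>x. E x (g p)) \<circ> inv_into U \<phi>) (at (\<phi> (f p)))
             (frechet_derivative (\<phi> \<circ> f \<circ> inv_into Z \<zeta>) (at (\<zeta> p)) d) +
           frechet_derivative (\<psi> \<circ> (\<lambda>y. E (f p) y) \<circ> inv_into V \<eta>) (at (\<eta> (g p)))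
             (frechet_derivative (\<eta> \<circ> g \<circ> inv_into Z \<zeta>) (at (\<zeta> p)) d))) (at (\<zeta> p))"
      using coord_chain2_split[of B C D E "\<lambda>x. f (inv_into Z \<zeta> x)" "\<zeta> p" "\<lambda>x. g (inv_into Z \<zeta> x)"
          U \<phi> V \<eta> W \<psi>, OF _ B C _ _ _ _ _ _ 1(1) 2(1) 1(2) 2(2)] E U V True cz by simp
    from frechet_derivative_at[OF this] show ?thesis
      unfolding tmap_def using True U V by (simp add: s s1 s2 o_def fun_eq_iff)
  qed
qed

section \<open>Logarithmic derivatives and admissible inputs on Lie groups\<close>

locale lie_group_atlas =
  fixes G :: "'g::{t2_space,second_countable_topology} monoid" (structure)
    and A :: "('g, 'a::real_normed_vector) atlas"
  assumes lie_group: "lie_group G A"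
begin

lemma carrier_UNIV [simp]: "carrier G = UNIV"
  using lie_group unfolding lie_group_def by blast

sublocale group G
  using lie_group unfolding lie_group_def by blast

lemma manifold: "smooth_manifold A"
  using lie_group unfolding lie_group_def by blast

lemma mult_mdiff: "mdiff_at (prod_atlas A A) A (\<lambda>(X, Y). X \<otimes> Y) p"
  using lie_group unfolding lie_group_def by (blast intro: smooth_map_mdiff_at)

lemma inv_mdiff: "mdiff_at A A (\<lambda>X. inv X) p"
  using lie_group unfolding lie_group_def by (blast intro: smooth_map_mdiff_at)

lemma left_mult_mdiff: "mdiff_at A A (\<lambda>Y. X \<otimes> Y) p"
  by (rule mdiff_at_partial(2)[OF mult_mdiff manifold manifold])

lemma tmap_left_mult_left_shift:
  "tmap A A (\<lambda>Y. Z \<otimes> Y) X (left_shift G A X u) = left_shift G A (Z \<otimes> X) u"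
proof -
  have "(\<lambda>Y. Z \<otimes> Y) \<circ> (\<lambda>Y. X \<otimes> Y) = (\<lambda>Y. Z \<otimes> X \<otimes> Y)" by (simp add: fun_eq_iff m_assoc)
  then show ?thesis
    using tmap_compose[OF manifold manifold left_mult_mdiff left_mult_mdiff, of Z X \<one> u]
    unfolding left_shift_def by simp
qed

definition log_derivative :: "'g \<Rightarrow> ('g, 'a) tvec \<Rightarrow> ('g, 'a) tvec" where
  "log_derivative X v = tmap A A (\<lambda>Y. inv X \<otimes> Y) X v"

lemma log_derivative_in_lie_alg: "log_derivative X v \<in> lie_alg G A"
  using tmap_in_tangent_space[OF manifold manifold left_mult_mdiff, of "inv X" X v]
  unfolding log_derivative_def lie_alg_def by simp

lemma lie_alg_nonempty: "\<exists>u. u \<in> lie_alg G A"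
  using log_derivative_in_lie_alg by blast

lemma left_shift_log_derivative:
  assumes "v \<in> tangent_space A X"
  shows "left_shift G A X (log_derivative X v) = v"
proof -
  have "(\<lambda>Y. X \<otimes> Y) \<circ> (\<lambda>Y. inv X \<otimes> Y) = id"
    by (simp add: fun_eq_iff m_assoc[symmetric])
  then show ?thesis
    using tmap_compose[OF manifold manifold left_mult_mdiff left_mult_mdiff, of X "inv X" X v]
      tmap_id[OF manifold assms]
    unfolding left_shift_def log_derivative_def by simp
qed

lemma log_derivative_one:
  assumes "v \<in> lie_alg G A"
  shows "log_derivative \<one> v = v"
proof -
  have "(\<lambda>Y. inv \<one> \<otimes> Y) = id" by (simp add: fun_eq_iff)
  then show ?thesis
    using tmap_id[OF manifold, of v \<one>] assms unfolding log_derivative_def lie_alg_def by metis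
qed

text \<open>
  The function \<open>Y \<mapsto> (Z Y)(X Y)\<^sup>-\<^sup>1\<close> is constant; differentiated at \<open>Y = \<one>\<close> in direction \<open>u\<close> by
  \<open>tmap_map2\<close>, it yields exactly the velocity that \<open>has_velocity_map2\<close> gives for the quotient curve.
\<close>

lemma quotient_velocity_zero:
  assumes Z: "has_velocity A Z (left_shift G A (Z t) u) t"
    and X: "has_velocity A X (left_shift G A (X t) u) t"
  shows "has_velocity A (\<lambda>s. Z s \<otimes> inv (X s)) (\<lambda>_. 0) t"
proof -
  note M = manifold
  have Xi: "has_velocity A (\<lambda>s. inv (X s)) (tmap A A (\<lambda>X. inv X) (X t) (left_shift G A (X t) u)) t"
    by (rule has_velocity_map[OF M M X inv_mdiff])
  have comp: "(\<lambda>X. inv X) \<circ> (\<lambda>Y. X t \<otimes> Y) = (\<lambda>Y. inv (X t \<otimes> Y))" by (simp add: fun_eq_iff)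
  have g: "tmap A A (\<lambda>Y. inv (X t \<otimes> Y)) \<one> u = tmap A A (\<lambda>X. inv X) (X t) (left_shift G A (X t) u)"
    using tmap_compose[OF M M left_mult_mdiff inv_mdiff, of "X t" \<one> u]
    unfolding left_shift_def comp by simp
  have gd: "mdiff_at A A (\<lambda>Y. inv (X t \<otimes> Y)) \<one>"
    using mdiff_at_compose[OF M M left_mult_mdiff inv_mdiff, of "X t" \<one>] unfolding comp .
  have "(\<lambda>Y. Z t \<otimes> Y \<otimes> inv (X t \<otimes> Y)) = (\<lambda>Y. Z t \<otimes> inv (X t))"
    by (simp add: fun_eq_iff inv_mult_group m_assoc) (simp add: m_assoc[symmetric])
  then have "tmap A A (\<lambda>Y. Z t \<otimes> Y \<otimes> inv (X t \<otimes> Y)) \<one> u = (\<lambda>_. 0)"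
    by (simp add: tmap_const)
  moreover note tmap_map2[OF M M M left_mult_mdiff gd, of A "\<lambda>X Y. X \<otimes> Y" "Z t" u] mult_mdiff
  ultimately have "(\<lambda>c. tmap A A (\<lambda>x. x \<otimes> inv (X t)) (Z t) (left_shift G A (Z t) u) c +
      tmap A A (\<lambda>y. Z t \<otimes> y) (inv (X t))
        (tmap A A (\<lambda>X. inv X) (X t) (left_shift G A (X t) u)) c) = (\<lambda>_. 0)"
    by (simp add: g left_shift_def)
  then show ?thesis using has_velocity_map2[OF M M M Z Xi mult_mdiff] by simp
qed

text \<open>
  One solution on the whole line is enough: left translation carries it to every initial value, and
  constancy of the quotient of two solutions gives uniqueness.
\<close>

lemma admissible_if_solution:
  assumes u: "\<And>t. u t \<in> lie_alg G A"
    and X: "\<And>t. has_velocity A X (left_shift G A (X t) (u t)) t"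
  shows "admissible G A u"
    and "has_velocity A (\<lambda>s. Z \<otimes> X s) (left_shift G A (Z \<otimes> X t) (u t)) t"
proof -
  show sol: "has_velocity A (\<lambda>s. Z \<otimes> X s) (left_shift G A (Z \<otimes> X t) (u t)) t" for Z t
    using has_velocity_map[OF manifold manifold X[of t] left_mult_mdiff, of Z]
    by (simp add: tmap_left_mult_left_shift)
  have uniq: "Z t = X0 \<otimes> inv (X 0) \<otimes> X t"
    if "Z 0 = X0" "\<forall>t. has_velocity A Z (left_shift G A (Z t) (u t)) t" for Z X0 t
  proof -
    have "Z t \<otimes> inv (X t) = Z 0 \<otimes> inv (X 0)"
      using zero_velocity_constant[OF manifold, of "\<lambda>s. Z s \<otimes> inv (X s)"]
        quotient_velocity_zero that(2) X by blast
    then show ?thesis using that(1) by (simp add: inv_solve_right')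
  qed
  have "\<exists>!Z. Z 0 = X0 \<and> (\<forall>t. has_velocity A Z (left_shift G A (Z t) (u t)) t)" for X0
  proof (rule ex1I[of _ "\<lambda>t. X0 \<otimes> inv (X 0) \<otimes> X t"])
    show "X0 \<otimes> inv (X 0) \<otimes> X 0 = X0 \<and> (\<forall>t. has_velocity A (\<lambda>t. X0 \<otimes> inv (X 0) \<otimes> X t)
        (left_shift G A (X0 \<otimes> inv (X 0) \<otimes> X t) (u t)) t)"
      by (intro conjI allI sol) (simp add: m_assoc)
  qed (use uniq in \<open>blast\<close>)
  then show "admissible G A u" unfolding admissible_def using u by blast
qed

text \<open>
  In charts the logarithmic derivative is the partial derivative of the multiplication in its second
  argument, evaluated along the continuous curve \<open>(X\<^sup>-\<^sup>1, X)\<close>, and the multiplication is continuously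
  differentiable.
\<close>

lemma log_derivative_continuous:
  assumes U: "(U, \<phi>) \<in> A" "\<And>t. X t \<in> U" and X: "\<And>t. has_velocity A X (w t) t"
    and w: "\<And>t. w t (U, \<phi>) = b t *\<^sub>R a" and b: "continuous_on UNIV (b :: real \<Rightarrow> real)"
  shows "continuous_on UNIV (\<lambda>t. log_derivative (X t) (w t) c)"
proof -
  note M = manifold
  obtain W \<psi> where c: "c = (W, \<psi>)" by (cases c)
  have wt: "w t \<in> tangent_space A (X t)" for t using X[of t] unfolding has_velocity_def by blast
  have cX: "continuous_on UNIV X"
    using X unfolding has_velocity_def by (simp add: continuous_on_eq_continuous_at)
  have cXi: "continuous_on UNIV (\<lambda>t. inv (X t))"
    using isCont_o2[where f = X, OF _ mdiff_at_isCont[OF inv_mdiff]] X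
    unfolding has_velocity_def by (simp add: continuous_on_eq_continuous_at)
  show ?thesis
  proof (cases "(W, \<psi>) \<in> A \<and> \<one> \<in> W")
    case False
    then have "log_derivative (X t) (w t) c = 0" for t
      unfolding c log_derivative_def by (intro tmap_outside) simp
    then show ?thesis by simp
  next
    case True
    have "isCont (\<lambda>t. log_derivative (X t) (w t) c) t1" for t1
    proof -
      obtain V \<eta> where V: "(V, \<eta>) \<in> A" "inv (X t1) \<in> V" using smooth_manifold_obtain_chart[OF M] .
      note cu = smooth_manifold_chart[OF M U(1)] and cv = smooth_manifold_chart[OF M V(1)]
      let ?m = "\<lambda>(X, Y). X \<otimes> Y"
      let ?f = "\<psi> \<circ> ?m \<circ> inv_into (V \<times> U) (map_prod \<eta> \<phi>)"
      let ?S = "map_prod \<eta> \<phi> ` ((V \<times> U) \<inter> ?m -` W)"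
      let ?T = "(\<lambda>t. inv (X t)) -` V"
      have P: "(V \<times> U, map_prod \<eta> \<phi>) \<in> prod_atlas A A"
        using U(1) V(1) unfolding prod_atlas_def by blast
      then have "smooth_on ?S ?f"
        using lie_group True unfolding lie_group_def smooth_map_def by blast
      then have cD: "continuous_on ?S (\<lambda>z. frechet_derivative ?f (at z) (0, a))"
        by (rule smooth_on_continuous_derivative)
      have T: "open ?T" "t1 \<in> ?T" using open_vimage[OF cv(1) cXi] V(2) by auto
      have "continuous_on ?T (\<lambda>t. (\<eta> (inv (X t)), \<phi> (X t)))"
        by (intro continuous_on_Pair continuous_on_compose2[OF cv(4)] continuous_on_compose2[OF cu(4)]
            continuous_on_subset[OF cX] continuous_on_subset[OF cXi]) (use U(2) in auto)
      moreover have "(\<eta> (inv (X t)), \<phi> (X t)) \<in> ?S" if "t \<in> ?T" for t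
        using that U(2)[of t] True by (intro image_eqI[of _ _ "(inv (X t), X t)"]) auto
      ultimately have "continuous_on ?T
          (\<lambda>t. b t *\<^sub>R frechet_derivative ?f (at (\<eta> (inv (X t)), \<phi> (X t))) (0, a))"
        by (intro continuous_on_scaleR continuous_on_subset[OF b] continuous_on_compose2[OF cD]) auto
      moreover have "b t *\<^sub>R frechet_derivative ?f (at (\<eta> (inv (X t)), \<phi> (X t))) (0, a) =
          log_derivative (X t) (w t) c" if t: "t \<in> ?T" for t
      proof -
        have Vt: "inv (X t) \<in> V" using t by simp
        have W: "(W, \<psi>) \<in> A" "inv (X t) \<otimes> X t \<in> W" using True by auto
        have W': "(case (inv (X t), X t) of (X, Y) \<Rightarrow> X \<otimes> Y) \<in> W" using W by simp
        have "linear (frechet_derivative ?f (at (\<eta> (inv (X t)), \<phi> (X t))))"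
          using mdiff_at_has_derivative[OF mult_mdiff P _ W(1) W'] Vt U(2)
          by (auto intro: has_derivative_linear)
        from linear_scale[OF this, of "b t" "(0, a)"]
        have "b t *\<^sub>R frechet_derivative ?f (at (\<eta> (inv (X t)), \<phi> (X t))) (0, a) =
            frechet_derivative ?f (at (\<eta> (inv (X t)), \<phi> (X t))) (0, w t (U, \<phi>))"
          by (simp add: w)
        also have "\<dots> = frechet_derivative (\<psi> \<circ> (\<lambda>Y. inv (X t) \<otimes> Y) \<circ> inv_into U \<phi>)
            (at (\<phi> (X t))) (w t (U, \<phi>))"
          by (rule fun_cong[OF frechet_derivative_at[OF
                partial_derivatives(2)[OF mult_mdiff M M V(1) Vt U(1) U(2) W]]])
        also have "\<dots> = log_derivative (X t) (w t) c"
          unfolding c log_derivative_def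
          by (rule tmap_chart[OF M left_mult_mdiff wt U(1) U(2) W, symmetric])
        finally show ?thesis .
      qed
      ultimately have "continuous_on ?T (\<lambda>t. log_derivative (X t) (w t) c)"
        by (rule continuous_on_eq)
      then show ?thesis using T by (simp add: continuous_on_eq_continuous_at)
    qed
    then show ?thesis by (simp add: continuous_on_eq_continuous_at)
  qed
qed

lemma admissible_input_through:
  assumes u0: "u0 \<in> lie_alg G A"
  obtains u X where "admissible G A u" "\<And>c. continuous_on UNIV (\<lambda>t. u t c)" "u t0 = u0"
    "X t0 = X0" "\<And>t. has_velocity A X (left_shift G A (X t) (u t)) t"
proof -
  obtain X w b U \<phi> where U: "(U, \<phi>) \<in> A" "\<And>t. X t \<in> U" and X0: "X t0 = \<one>"
    and X: "\<And>t. has_velocity A X (w t) t" and w0: "w t0 = u0"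
    and w: "\<And>t. w t (U, \<phi>) = b t *\<^sub>R u0 (U, \<phi>)" and b: "continuous_on UNIV (b :: real \<Rightarrow> real)"
    using curve_through[OF manifold u0[unfolded lie_alg_def]] by metis
  define u where "u t = log_derivative (X t) (w t)" for t
  have u: "u t \<in> lie_alg G A" for t unfolding u_def by (rule log_derivative_in_lie_alg)
  have "w t \<in> tangent_space A (X t)" for t using X[of t] unfolding has_velocity_def by blast
  then have sol: "has_velocity A X (left_shift G A (X t) (u t)) t" for t
    using X[of t] unfolding u_def by (simp add: left_shift_log_derivative)
  show ?thesis
  proof (rule that)
    show "admissible G A u" by (rule admissible_if_solution(1)[OF u sol])
    show "continuous_on UNIV (\<lambda>t. u t c)" for c
      unfolding u_def by (rule log_derivative_continuous[OF U X w b])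
    show "u t0 = u0" unfolding u_def X0 w0 by (rule log_derivative_one[OF u0])
    show "X0 \<otimes> X t0 = X0" by (simp add: X0)
    show "has_velocity A (\<lambda>t. X0 \<otimes> X t) (left_shift G A (X0 \<otimes> X t) (u t)) t" for t
      by (rule admissible_if_solution(2)[OF u sol])
  qed
qed

end

section \<open>The projected system and the canonical error\<close>

locale transitive_lie_action = lie_group_atlas G A
  for G :: "'g::{t2_space,second_countable_topology} monoid" (structure)
    and A :: "('g, 'a::real_normed_vector) atlas" +
  fixes B :: "('m::{t2_space,second_countable_topology}, 'b::real_normed_vector) atlas"
    and h :: "'g \<Rightarrow> 'm \<Rightarrow> 'm"
  assumes manifold_B: "smooth_manifold B"
    and action: "right_lie_action G A B h"
    and transitive: "transitive_act h"
begin

lemma act_one [simp]: "h \<one> y = y"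
  using action unfolding right_lie_action_def by blast

lemma act_act: "h X (h Y y) = h (Y \<otimes> X) y"
  using action unfolding right_lie_action_def by blast

lemma act_inv [simp]: "h X (h (inv X) y) = y" "h (inv X) (h X y) = y"
  by (simp_all add: act_act)

lemma obtain_mover:
  obtains X where "h X y = z"
  using transitive unfolding transitive_act_def by blast

lemma act_mdiff: "mdiff_at (prod_atlas A B) B (\<lambda>(X, y). h X y) p"
  using action unfolding right_lie_action_def by (blast intro: smooth_map_mdiff_at)

lemma orbit_mdiff: "mdiff_at A B (\<lambda>X. h X y) X"
  by (rule mdiff_at_partial(1)[OF act_mdiff manifold manifold_B])

lemma translation_mdiff: "mdiff_at B B (h X) y"
  using mdiff_at_partial(2)[OF act_mdiff manifold manifold_B] .

text \<open>
  The projected field is the infinitesimal action: by \<open>h(XY, y) = h(Y, h(X, y))\<close>, the vector pushed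
  down from \<open>X\<close> depends on the point \<open>h(X, y)\<close> only, which also shows that any representative may be
  chosen in \<open>proj_field\<close>.
\<close>

lemma tmap_orbit_left_shift:
  "tmap A B (\<lambda>Y. h Y y) X (left_shift G A X u) = tmap A B (\<lambda>Y. h Y (h X y)) \<one> u"
proof -
  have "(\<lambda>Y. h Y y) \<circ> (\<lambda>Y. X \<otimes> Y) = (\<lambda>Y. h Y (h X y))" by (simp add: fun_eq_iff act_act)
  then show ?thesis
    using tmap_compose[OF manifold manifold left_mult_mdiff[of X \<one>] orbit_mdiff[of y], of u]
    unfolding left_shift_def by simp
qed

lemma proj_field_eq: "proj_field G A B h y0 y u = tmap A B (\<lambda>Y. h Y y) \<one> u"
proof -
  have "h (SOME X. h X y0 = y) y0 = y"
    using someI_ex[of "\<lambda>X. h X y0 = y"] obtain_mover by metis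
  then show ?thesis unfolding proj_field_def Let_def tmap_orbit_left_shift by simp
qed

lemma proj_solution_of_lift:
  assumes "\<And>t. has_velocity A X (left_shift G A (X t) (u t)) t"
  shows "proj_solution G A B h y0 u (\<lambda>t. h (X t) y0)"
  unfolding proj_solution_def proj_field_eq
  using has_velocity_map[OF manifold manifold_B assms orbit_mdiff]
  by (auto simp flip: tmap_orbit_left_shift)

lemma tmap_translation_compose:
  "tmap B B (h X) (h Y y) (tmap B B (h Y) y v) = tmap B B (h (Y \<otimes> X)) y v"
  using tmap_compose[OF manifold_B manifold_B translation_mdiff translation_mdiff, of X Y y v]
  by (simp add: o_def act_act)

lemma tmap_translation_one:
  assumes "v \<in> tangent_space B y"
  shows "tmap B B (h \<one>) y v = v"
proof -
  have "h \<one> = id" by (simp add: fun_eq_iff)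
  then show ?thesis using tmap_id[OF manifold_B assms] by simp
qed

context
  fixes y0 :: 'm and e :: "'m \<Rightarrow> 'm \<Rightarrow> 'm" and \<alpha> :: "('g, 'a, 'm, 'b) innov"
  assumes error: "canonical_error G B h y0 e"
begin

lemma error_translate: "e z (h X y0) = h (inv X) z"
proof -
  obtain Z where "z = h Z y0" using obtain_mover by metis
  then show ?thesis using error unfolding canonical_error_def by (simp add: act_act)
qed

lemma error_invariant: "e (h Y z) (h Y y) = e z y"
proof -
  obtain X where "y = h X y0" using obtain_mover by metis
  then show ?thesis
    by (simp add: error_translate act_act inv_mult_group)
       (simp add: act_act[symmetric])
qed

lemma error_mdiff: "mdiff_at (prod_atlas B B) B (\<lambda>(z, y). e z y) p"
  using error unfolding canonical_error_def by (blast intro: smooth_map_mdiff_at)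

text \<open>
  The infinitesimal action at \<open>yh t\<close> and \<open>y t\<close> contributes zero because \<open>Y \<mapsto> e (h Y (yh t)) (h Y (y t))\<close> is
  constant, and \<open>z \<mapsto> e z (y t)\<close> is the translation by \<open>inv X\<close>. Hence only the innovation remains.
\<close>

lemma error_velocity:
  assumes y: "proj_solution G A B h y0 u y" and yh: "obs_solution G A B h y0 \<alpha> u y I yh"
    and t: "t \<in> I" and X: "h X y0 = y t"
  shows "has_velocity B (\<lambda>s. e (yh s) (y s))
           (tmap B B (h (inv X)) (yh t) (\<alpha> (yh t) (u t) (y t) t)) t"
proof -
  note M = manifold_B
  let ?f = "\<lambda>z. tmap A B (\<lambda>Y. h Y z) \<one> (u t)"
  let ?a = "\<alpha> (yh t) (u t) (y t) t"
  note de = mdiff_at_partial[OF error_mdiff M M]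
  have v: "has_velocity B y (?f (y t)) t"
    using y unfolding proj_solution_def proj_field_eq by blast
  have w: "has_velocity B yh (\<lambda>c. ?f (yh t) c + ?a c) t"
    using yh t unfolding obs_solution_def proj_field_eq by blast
  have ex: "(\<lambda>z. e z (y t)) = h (inv X)" using error_translate X[symmetric] by (simp add: fun_eq_iff)
  have inv: "(\<lambda>c. tmap B B (\<lambda>z. e z (y t)) (yh t) (?f (yh t)) c +
      tmap B B (\<lambda>z. e (yh t) z) (y t) (?f (y t)) c) = (\<lambda>_. 0)"
    using tmap_map2[OF manifold M M orbit_mdiff[of "yh t" \<one>] orbit_mdiff[of "y t"] error_mdiff, of "u t"]
    by (simp add: error_invariant tmap_const)
  have "tmap B B (\<lambda>z. e z (y t)) (yh t) (\<lambda>c. ?f (yh t) c + ?a c) c +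
      tmap B B (\<lambda>z. e (yh t) z) (y t) (?f (y t)) c = tmap B B (h (inv X)) (yh t) ?a c" for c
    using fun_cong[OF inv, of c] unfolding tmap_add[OF M de(1)] by (simp add: ex algebra_simps)
  then show ?thesis using has_velocity_map2[OF M M M w v error_mdiff] by simp
qed

context
  assumes tangent: "\<And>yh u y t. u \<in> lie_alg G A \<Longrightarrow> \<alpha> yh u y t \<in> tangent_space B yh"
begin

lemma error_dynamics_if_equivariant:
  assumes eq: "equivariant G A B h \<alpha>"
    and a: "\<And>yh u y t. u \<in> lie_alg G A \<Longrightarrow> \<alpha> yh u y t = a yh y"
  shows "has_error_dynamics G A B h y0 \<alpha> e (\<lambda>x. a x y0)"
proof -
  obtain u0 where u0: "u0 \<in> lie_alg G A" using lie_alg_nonempty by blast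
  have "a x y0 \<in> tangent_space B x" for x using tangent[OF u0] a[OF u0] by metis
  moreover have "has_velocity B (\<lambda>s. e (yh s) (y s)) (a (e (yh t) (y t)) y0) t"
    if u: "admissible G A u" and y: "proj_solution G A B h y0 u y"
      and yh: "obs_solution G A B h y0 \<alpha> u y I yh" and t: "t \<in> I" for u y I yh t
  proof -
    obtain X where X: "h X y0 = y t" using obtain_mover .
    have ut: "u t \<in> lie_alg G A" using u unfolding admissible_def by blast
    have "tmap B B (h (inv X)) (yh t) (\<alpha> (yh t) (u t) (y t) t) =
        \<alpha> (h (inv X) (yh t)) (u t) (h (inv X) (y t)) t"
      using eq ut unfolding equivariant_def by blast
    also have "\<dots> = a (e (yh t) (y t)) y0"
      using X[symmetric] ut by (simp add: a error_translate)
    finally show ?thesis using error_velocity[OF y yh t X] by simp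
  qed
  ultimately show ?thesis unfolding has_error_dynamics_def by blast
qed

context
  assumes solvable: "obs_solvable G A B h y0 \<alpha>"
begin

text \<open>
  Choose an input with value \<open>u0\<close> at time \<open>t\<close> for which the system is at \<open>h X y0\<close> and the observer at \<open>z\<close>
  at that time, and compare the two expressions for the velocity of the error there.
\<close>

lemma innovation_eq_if_error_dynamics:
  assumes F: "has_error_dynamics G A B h y0 \<alpha> e F" and u0: "u0 \<in> lie_alg G A"
  shows "\<alpha> z u0 (h X y0) t = tmap B B (h X) (h (inv X) z) (F (h (inv X) z))"
proof -
  obtain u Y where u: "admissible G A u" "\<And>c. continuous_on UNIV (\<lambda>t. u t c)" "u t = u0"
    and Y: "Y t = X" "\<And>t. has_velocity A Y (left_shift G A (Y t) (u t)) t"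
    using admissible_input_through[OF u0] by metis
  define y where "y = (\<lambda>t. h (Y t) y0)"
  have y: "proj_solution G A B h y0 u y" unfolding y_def by (rule proj_solution_of_lift[OF Y(2)])
  have yt: "h X y0 = y t" unfolding y_def by (simp add: Y)
  obtain I yh where yh: "t \<in> I" "obs_solution G A B h y0 \<alpha> u y I yh" "yh t = z"
    using solvable[unfolded obs_solvable_def, THEN spec, THEN spec, THEN mp,
        OF conjI[OF u(1) conjI[OF allI[OF u(2)] y]]] by metis
  have "has_velocity B (\<lambda>s. e (yh s) (y s)) (F (e (yh t) (y t))) t"
    using F u y yh unfolding has_error_dynamics_def by blast
  from has_velocity_unique[OF this error_velocity[OF y yh(2,1) yt]]
  have "F (h (inv X) z) = tmap B B (h (inv X)) z (\<alpha> z u0 (h X y0) t)"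
    unfolding yt[symmetric] yh(3) u(3) error_translate .
  then show ?thesis
    using tmap_translation_one[OF tangent[OF u0]] by (simp add: tmap_translation_compose)
qed

lemma equivariant_if_error_dynamics:
  assumes F: "has_error_dynamics G A B h y0 \<alpha> e F"
  shows "equivariant G A B h \<alpha>" "indep_of_input_time G A \<alpha>"
proof -
  note eq = innovation_eq_if_error_dynamics[OF F]
  have "tmap B B (h S) z (\<alpha> z u y t) = \<alpha> (h S z) u (h S y) t" if u: "u \<in> lie_alg G A" for S z u y t
  proof -
    obtain X where X: "y = h X y0" using obtain_mover by metis
    have *: "h (inv (X \<otimes> S)) (h S z) = h (inv X) z"
      by (simp add: act_act inv_mult_group m_assoc[symmetric])
    have "tmap B B (h S) z (\<alpha> z u y t) = tmap B B (h (X \<otimes> S)) (h (inv X) z) (F (h (inv X) z))"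
      using tmap_translation_compose[of S X "h (inv X) z"] unfolding X eq[OF u] by simp
    also have "\<dots> = \<alpha> (h S z) u (h (X \<otimes> S) y0) t" unfolding eq[OF u] * ..
    finally show ?thesis unfolding X by (simp add: act_act)
  qed
  then show "equivariant G A B h \<alpha>" unfolding equivariant_def by blast
  have "\<alpha> z u y t = \<alpha> z u' y t'" if "u \<in> lie_alg G A" "u' \<in> lie_alg G A" for z u u' y t t'
  proof -
    obtain X where "y = h X y0" using obtain_mover by metis
    then show ?thesis using eq that by simp
  qed
  then show "indep_of_input_time G A \<alpha>" unfolding indep_of_input_time_def by blast
qed

end

end

end

end

theorem theorem16:
  fixes G :: "'g::{t2_space,second_countable_topology} monoid"
    and A :: "('g, 'a::real_normed_vector) atlas"
    and B :: "('m::{t2_space,second_countable_topology}, 'b::real_normed_vector) atlas"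
    and h :: "'g \<Rightarrow> 'm \<Rightarrow> 'm"
    and y0 :: 'm
    and \<alpha> :: "('g, 'a, 'm, 'b) innov"
    and e :: "'m \<Rightarrow> 'm \<Rightarrow> 'm"
  assumes "lie_group G A" and "connected (UNIV :: 'g set)"
    and "smooth_manifold B" and "connected (UNIV :: 'm set)"
    and "right_lie_action G A B h" and "transitive_act h"
    and "closed (stab h y0)"
    and "canonical_error G B h y0 e"
    and "innovation_term G A B h y0 \<alpha>"
    and "obs_solvable G A B h y0 \<alpha>"
    and "internal_model G A B h y0 \<alpha>"
  shows "(autonomous_error G A B h y0 \<alpha> e \<longleftrightarrow>
            equivariant G A B h \<alpha> \<and> indep_of_input_time G A \<alpha>) \<and>
         (autonomous_error G A B h y0 \<alpha> e \<longrightarrow>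
            (\<exists>a. (\<forall>yh y t. \<forall>u\<in>lie_alg G A. \<alpha> yh u y t = a yh y) \<and>
                 has_error_dynamics G A B h y0 \<alpha> e (\<lambda>x. a x y0)))"
proof -
  interpret transitive_lie_action G A B h
    using assms by unfold_locales
  have tangent: "\<alpha> yh u y t \<in> tangent_space B yh" if "u \<in> lie_alg G A" for yh u y t
    using assms(9) that unfolding innovation_term_def by blast
  note error = assms(8) and solvable = assms(10)
  obtain u0 where u0: "u0 \<in> lie_alg G A" using lie_alg_nonempty by blast
  define a where "a yh y = \<alpha> yh u0 y 0" for yh y
  have a: "\<alpha> yh u y t = a yh y" if "indep_of_input_time G A \<alpha>" "u \<in> lie_alg G A" for yh u y t
    using that u0 unfolding indep_of_input_time_def a_def by blast
  have if_direction: "has_error_dynamics G A B h y0 \<alpha> e (\<lambda>x. a x y0)"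
    if "equivariant G A B h \<alpha>" "indep_of_input_time G A \<alpha>"
    by (rule error_dynamics_if_equivariant[OF error tangent that(1) a[OF that(2)]])
  have only_if: "equivariant G A B h \<alpha> \<and> indep_of_input_time G A \<alpha>"
    if "autonomous_error G A B h y0 \<alpha> e"
    using that equivariant_if_error_dynamics[OF error tangent solvable]
    unfolding autonomous_error_def by blast
  show ?thesis
    using if_direction only_if a unfolding autonomous_error_def by blast
qed

end
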